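(* Let $f=a/d^{\,j}\in\mathbb F(\mathbf x)$ where $j\ge1$, $a\in\mathbb F(x_2,\dots,x_m)[x_1]$, $d\in\mathbb F[\mathbf x]$ is irreducible with $\deg_{x_1}(d)>0$ and $\deg_{x_1}(a)<\deg_{x_1}(d)$. Let $\{\tau_1,\dots,\tau_r\}$ be a basis of the free abelian group $G_d$ (if $G_d=\{\mathbf 1\}$, take $r=1$, $\tau_1=\mathbf 1$ the identity). Then $f$ is $(\sigma_{x_1},\dots,\sigma_{x_n})$-summable in $\mathbb F(\mathbf x)$ if and only if $$a=\Delta_{\tau_1}(b_1)+\cdots+\Delta_{\tau_r}(b_r)$$ for some $b_i\in\mathbb F(x_2,\dots,x_m)[x_1]$ with $\deg_{x_1}(b_i)<\deg_{x_1}(d)$ for all $1\le i\le r$.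
   Context: $\mathbb F$ is a field of characteristic zero, $\mathbf x=(x_1,\dots,x_m)$, $1\le n\le m$. $\sigma_{x_i}$ is the $\mathbb F$-automorphism of $\mathbb F(\mathbf x)$ with $\sigma_{x_i}(x_i)=x_i+1$, fixing the other variables; $G=\langle\sigma_{x_1},\dots,\sigma_{x_n}\rangle$. For $\tau\in G$, $\Delta_\tau(g)=\tau(g)-g$. $f$ is $(\sigma_{x_1},\dots,\sigma_{x_n})$-summable in $\mathbb F(\mathbf x)$ if $f=\sum_{i=1}^n(\sigma_{x_i}(g_i)-g_i)$ for some $g_i\in\mathbb F(\mathbf x)$. The isotropy group of $d$ in $G$ is $G_d=\{\tau\in G:\tau(d)=d\}$. *)

theory Defs
  imports "HOL-Library.Poly_Mapping" "HOL-Computational_Algebra.Fraction_Field"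
begin

text \<open>Multivariate polynomials over a field: variables are indexed by natural numbers,
  x_i being the variable with index i (we use the indices 1..m).
  A monomial is an exponent vector nat =>0 nat, a polynomial a finitely supported map
  from monomials to coefficients.  Its fraction field is the rational function field.\<close>

type_synonym 'a mpoly = "(nat \<Rightarrow>\<^sub>0 nat) \<Rightarrow>\<^sub>0 'a"

definition mconst :: "'a::comm_ring_1 \<Rightarrow> 'a mpoly" where
  "mconst c = Poly_Mapping.single 0 c"

definition mvar :: "nat \<Rightarrow> 'a::comm_ring_1 mpoly" where
  "mvar i = Poly_Mapping.single (Poly_Mapping.single i 1) 1"

definition poly_in_vars :: "nat set \<Rightarrow> 'a::comm_ring_1 mpoly \<Rightarrow> bool" where
  "poly_in_vars V p \<longleftrightarrow> (\<forall>\<mu>\<in>Poly_Mapping.keys p. Poly_Mapping.keys \<mu> \<subseteq> V)"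

definition msubst :: "(nat \<Rightarrow> 'a::comm_ring_1 mpoly) \<Rightarrow> 'a mpoly \<Rightarrow> 'a mpoly" where
  "msubst s p = (\<Sum>\<mu>\<in>Poly_Mapping.keys p. mconst (Poly_Mapping.lookup p \<mu>) * (\<Prod>j\<in>Poly_Mapping.keys \<mu>. s j ^ Poly_Mapping.lookup \<mu> j))"

text \<open>Degree in the variable x_i (degree of the zero polynomial is 0 here).\<close>
definition deg_var :: "nat \<Rightarrow> 'a::comm_ring_1 mpoly \<Rightarrow> nat" where
  "deg_var i p = Max (insert 0 ((\<lambda>\<mu>. Poly_Mapping.lookup \<mu> i) ` Poly_Mapping.keys p))"

text \<open>Elements of G = <sigma_x1,...,sigma_xn> are written sigma_x1^k1 ... sigma_xn^kn;
  they are represented by their exponent vectors k :: nat => int with k j = 0 outside 1..n.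
  (The map k |-> sigma^k is an isomorphism Z^n -> G.)\<close>
definition shift_vecs :: "nat \<Rightarrow> (nat \<Rightarrow> int) set" where
  "shift_vecs n = {k. \<forall>j. j \<notin> {1..n} \<longrightarrow> k j = 0}"

definition shift_poly :: "(nat \<Rightarrow> int) \<Rightarrow> 'a::comm_ring_1 mpoly \<Rightarrow> 'a mpoly" where
  "shift_poly k p = msubst (\<lambda>j. mvar j + of_int (k j)) p"

definition shift :: "(nat \<Rightarrow> int) \<Rightarrow> 'a::idom mpoly fract \<Rightarrow> 'a mpoly fract" where
  "shift k f = (SOME g. \<exists>p q. q \<noteq> 0 \<and> f = Fract p q \<and> g = Fract (shift_poly k p) (shift_poly k q))"

definition unitvec :: "nat \<Rightarrow> nat \<Rightarrow> int" where
  "unitvec i = (\<lambda>j. if j = i then 1 else 0)"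

definition Delta :: "(nat \<Rightarrow> int) \<Rightarrow> 'a::idom mpoly fract \<Rightarrow> 'a mpoly fract" where
  "Delta k g = shift k g - g"

definition ratfun :: "nat \<Rightarrow> 'a::idom mpoly fract set" where
  "ratfun m = {Fract p q | p q. poly_in_vars {1..m} p \<and> poly_in_vars {1..m} q \<and> q \<noteq> 0}"

definition summable :: "nat \<Rightarrow> nat \<Rightarrow> 'a::idom mpoly fract \<Rightarrow> bool" where
  "summable m n f \<longleftrightarrow> (\<exists>g. (\<forall>i\<in>{1..n}. g i \<in> ratfun m) \<and>
      f = (\<Sum>i=1..n. shift (unitvec i) (g i) - g i))"

text \<open>b lies in F(x_2,...,x_m)[x_1] and deg_{x_1}(b) < N
  (the x_1-degree of p/q with q free of x_1 is deg_{x_1} p; the zero element qualifies).\<close>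
definition in_K_x1_deg_lt :: "nat \<Rightarrow> nat \<Rightarrow> 'a::idom mpoly fract \<Rightarrow> bool" where
  "in_K_x1_deg_lt m N b \<longleftrightarrow> (\<exists>p q. poly_in_vars {1..m} p \<and> poly_in_vars {2..m} q \<and> q \<noteq> 0
      \<and> b = Fract p q \<and> (p = 0 \<or> deg_var 1 p < N))"

definition irreducible_in :: "nat \<Rightarrow> 'a::idom mpoly \<Rightarrow> bool" where
  "irreducible_in m d \<longleftrightarrow> poly_in_vars {1..m} d \<and> d \<noteq> 0 \<and> \<not> d dvd 1 \<and>
     (\<forall>a b. poly_in_vars {1..m} a \<longrightarrow> poly_in_vars {1..m} b \<longrightarrow> d = a * b \<longrightarrow> a dvd 1 \<or> b dvd 1)"

definition isotropy :: "nat \<Rightarrow> 'a::idom mpoly \<Rightarrow> (nat \<Rightarrow> int) set" where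
  "isotropy n d = {k \<in> shift_vecs n. shift k (Fract d 1) = Fract d 1}"

definition group_basis :: "(nat \<Rightarrow> int) set \<Rightarrow> (nat \<Rightarrow> int) list \<Rightarrow> bool" where
  "group_basis H ts \<longleftrightarrow>
     (if H = {\<lambda>_. 0} then ts = [\<lambda>_. 0]
      else set ts \<subseteq> H \<and>
        (\<forall>c. (\<lambda>j. \<Sum>i<length ts. c i * (ts ! i) j) = (\<lambda>_. 0) \<longrightarrow> (\<forall>i<length ts. c i = 0)) \<and>
        (\<forall>k\<in>H. \<exists>c. k = (\<lambda>j. \<Sum>i<length ts. c i * (ts ! i) j)))"

end

theory Submission
  imports "HOL-Computational_Algebra.Polynomial" Defs
begin

text \<open>
  For an irreducible \<open>e\<close> of positive degree in \<open>x\<^sub>1\<close>, every rational function has a unique expansion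
  \<open>u + \<Sum>\<^sub>k \<alpha>\<^sub>k / e\<^sup>k\<close> with \<open>u\<close> regular at \<open>e\<close> and \<open>\<alpha>\<^sub>k \<in> K = F(x\<^sub>2,\<dots>,x\<^sub>m)[x\<^sub>1]\<close>, \<open>deg \<alpha>\<^sub>k < deg e\<close>; its
  \<open>j\<close>-th coefficient \<open>c\<^sub>e\<close> is additive and commutes with shifts. Choose \<open>\<tau>\<^sub>e \<in> G\<close> with \<open>\<tau>\<^sub>e d = e\<close> for
  each \<open>e\<close> in the orbit of \<open>d\<close> and put \<open>\<Phi> f = \<Sum>\<^sub>e \<tau>\<^sub>e\<^sup>-\<^sup>1 (c\<^sub>e f)\<close>. Then \<open>\<Phi> (\<sigma> g) - \<Phi> g\<close> is a sum of terms
  \<open>\<Delta>\<^sub>\<rho> b\<close> with \<open>\<rho> = \<tau>\<^bsub>\<sigma>e\<^esub>\<^sup>-\<^sup>1 \<sigma> \<tau>\<^sub>e\<close> in the isotropy group, whereas \<open>\<Phi> (a / d\<^sup>j)\<close> is \<open>a\<close> up to such a term;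
  hence a summable \<open>a / d\<^sup>j\<close> forces \<open>a\<close> into the span of the \<open>\<Delta>\<^sub>\<rho>\<close>. The converse is immediate because \<open>d\<close>
  is fixed by the isotropy group and \<open>\<Delta>\<^sub>\<tau> g\<close> is summable for every \<open>\<tau> \<in> G\<close>.
\<close>

section \<open>Substitution homomorphisms\<close>

locale comm_ring_hom =
  fixes \<phi> :: "'a::comm_ring_1 \<Rightarrow> 'b::comm_ring_1"
  assumes one: "\<phi> 1 = 1"
    and add: "\<phi> (x + y) = \<phi> x + \<phi> y"
    and mult: "\<phi> (x * y) = \<phi> x * \<phi> y"
begin

lemma zero: "\<phi> 0 = 0"
  using add[of 0 0] by simp

lemma uminus: "\<phi> (- x) = - \<phi> x"
  using add[of x "- x"] by (simp add: zero eq_neg_iff_add_eq_0 add.commute)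

lemma diff: "\<phi> (x - y) = \<phi> x - \<phi> y"
  using add[of x "- y"] by (simp add: uminus)

lemma power: "\<phi> (x ^ n) = \<phi> x ^ n"
  by (induction n) (simp_all add: one mult)

lemma sum: "\<phi> (sum f A) = (\<Sum>x\<in>A. \<phi> (f x))"
  by (induction A rule: infinite_finite_induct) (simp_all add: zero add)

lemma of_nat: "\<phi> (of_nat n) = of_nat n"
  by (induction n) (simp_all add: zero one add)

lemma of_int: "\<phi> (of_int k) = of_int k"
  by (cases k) (simp_all add: of_nat uminus one diff)

end

lemma comm_ring_hom_compose:
  assumes "comm_ring_hom f" "comm_ring_hom g"
  shows "comm_ring_hom (\<lambda>x. f (g x))"
proof -
  interpret f: comm_ring_hom f by fact
  interpret g: comm_ring_hom g by fact
  show ?thesis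
    by unfold_locales (simp_all add: f.one g.one f.add g.add f.mult g.mult)
qed

lemma comm_ring_hom_id: "comm_ring_hom (\<lambda>x. x)"
  by unfold_locales simp_all

lemma comm_ring_hom_const_poly: "comm_ring_hom (\<lambda>c. [:c:])"
  by unfold_locales (simp_all add: one_pCons)

lemma comm_ring_hom_poly: "comm_ring_hom (\<lambda>p. poly p a)"
  by unfold_locales simp_all

lemma comm_ring_hom_pcompose: "comm_ring_hom (\<lambda>p. pcompose p (q :: 'a::comm_ring_1 poly))"
  by unfold_locales (simp_all add: pcompose_add pcompose_mult pcompose_1)

lemma comm_ring_hom_mconst: "comm_ring_hom (mconst :: 'a::comm_ring_1 \<Rightarrow> 'a mpoly)"
  by unfold_locales (simp_all add: mconst_def single_add mult_single)

section \<open>Generators of the polynomial ring and induction over them\<close>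

lemma mpoly_sum_singles: "(p :: 'a::comm_ring_1 mpoly) =
    (\<Sum>\<mu>\<in>Poly_Mapping.keys p. Poly_Mapping.single \<mu> (Poly_Mapping.lookup p \<mu>))"
  by (rule poly_mapping_eqI)
    (auto simp: lookup_sum lookup_single when_def sum.delta in_keys_iff)

lemma mpoly_additive_induct [case_names single add]:
  fixes p :: "'a::comm_ring_1 mpoly"
  assumes single: "\<And>\<mu> c. P (Poly_Mapping.single \<mu> c)"
    and add: "\<And>p q. P p \<Longrightarrow> P q \<Longrightarrow> P (p + q)"
  shows "P p"
proof -
  have "P (\<Sum>\<mu>\<in>K. Poly_Mapping.single \<mu> (f \<mu>))" for K :: "(nat \<Rightarrow>\<^sub>0 nat) set" and f
    \<comment> \<open>The zero polynomial is the monomial with coefficient 0; this covers the empty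
      sum.\<close>
    using single[of 0 0]
    by (induction K rule: infinite_finite_induct) (auto intro: single add)
  then show ?thesis
    by (subst mpoly_sum_singles)
qed

lemma single_conv_mvar:
  "Poly_Mapping.single \<mu> c = mconst c *
     (\<Prod>j\<in>Poly_Mapping.keys \<mu>. mvar j ^ Poly_Mapping.lookup \<mu> j)"
proof -
  have pow: "mvar j ^ k = (Poly_Mapping.single (Poly_Mapping.single j k) 1 :: 'a mpoly)" for j k
    by (induction k) (simp_all add: mvar_def mult_single single_add[symmetric])
  have prod: "(\<Prod>j\<in>J. Poly_Mapping.single (f j) 1 :: 'a mpoly) = Poly_Mapping.single (sum f J) 1"
    for J :: "nat set" and f
    by (induction J rule: infinite_finite_induct) (simp_all add: mult_single)
  have "(\<Sum>j\<in>Poly_Mapping.keys \<mu>. Poly_Mapping.single j (Poly_Mapping.lookup \<mu> j)) = \<mu>"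
    by (rule poly_mapping_eqI)
      (auto simp: lookup_sum lookup_single when_def sum.delta in_keys_iff)
  then show ?thesis
    by (simp add: pow prod mconst_def mult_single)
qed

text \<open>The constants and the variables of \<open>V\<close> generate the polynomials in
  \<open>V\<close> as a ring, so a property closed under sums and products has to be checked only on
  them.\<close>

lemma poly_in_vars_induct [consumes 1, case_names mconst mvar add mult]:
  fixes p :: "'a::comm_ring_1 mpoly"
  assumes "poly_in_vars V p"
    and const: "\<And>c. P (mconst c)" and var: "\<And>i. i \<in> V \<Longrightarrow> P (mvar i)"
    and add: "\<And>p q. P p \<Longrightarrow> P q \<Longrightarrow> P (p + q)" and mult: "\<And>p q. P p \<Longrightarrow> P q \<Longrightarrow> P (p * q)"
  shows "P p"
proof -
  have one: "P 1"
    using const[of 1] by (simp add: comm_ring_hom.one[OF comm_ring_hom_mconst])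
  have zero: "P 0"
    using const[of 0] by (simp add: comm_ring_hom.zero[OF comm_ring_hom_mconst])
  have pow: "P (q ^ k)" if "P q" for q k
    by (induction k) (auto intro: one mult that)
  have prod: "P (prod f J)" if "\<And>j. j \<in> J \<Longrightarrow> P (f j)" for f and J :: "nat set"
    using that by (induction J rule: infinite_finite_induct) (auto intro: one mult)
  have sum: "P (sum f J)" if "\<And>j. j \<in> J \<Longrightarrow> P (f j)" for f and J :: "(nat \<Rightarrow>\<^sub>0 nat) set"
    using that by (induction J rule: infinite_finite_induct) (auto intro: zero add)
  have "P (Poly_Mapping.single \<mu> c)" if "\<mu> \<in> Poly_Mapping.keys p" for \<mu> c
    unfolding single_conv_mvar using assms(1) that
    by (intro mult const prod pow var) (auto simp: poly_in_vars_def)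
  then show ?thesis
    by (subst mpoly_sum_singles) (intro sum)
qed

lemma poly_in_vars_UNIV: "poly_in_vars UNIV p"
  by (simp add: poly_in_vars_def)

text \<open>A homomorphism is determined by its values on generators. Identities between composed
  substitutions are later reduced by this to constants and variables.\<close>

lemma hom_mpoly_eqI:
  fixes f g :: "'a::comm_ring_1 mpoly \<Rightarrow> 'b::comm_ring_1"
  assumes "comm_ring_hom f" "comm_ring_hom g"
    and "\<And>c. f (mconst c) = g (mconst c)" "\<And>i. i \<in> V \<Longrightarrow> f (mvar i) = g (mvar i)"
    and "poly_in_vars V p"
  shows "f p = g p"
proof -
  interpret f: comm_ring_hom f by fact
  interpret g: comm_ring_hom g by fact
  show ?thesis
    using assms(5) by (induction rule: poly_in_vars_induct)
      (simp_all add: assms(3,4) f.add g.add f.mult g.mult)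
qed

text \<open>Substitution, the univariate view \<open>univ\<close> and the restriction to a line are
  all instances, so the homomorphism laws are proved only once.\<close>

definition mpoly_eval ::
    "('a::comm_ring_1 \<Rightarrow> 'b::comm_ring_1) \<Rightarrow> (nat \<Rightarrow> 'b) \<Rightarrow> 'a mpoly \<Rightarrow> 'b" where
  "mpoly_eval \<phi> s p = (\<Sum>\<mu>\<in>Poly_Mapping.keys p. \<phi> (Poly_Mapping.lookup p \<mu>) *
     (\<Prod>j\<in>Poly_Mapping.keys \<mu>. s j ^ Poly_Mapping.lookup \<mu> j))"

lemma msubst_conv_mpoly_eval: "msubst s = mpoly_eval mconst s"
  by (simp add: msubst_def mpoly_eval_def fun_eq_iff)

context
  fixes \<phi> :: "'a::comm_ring_1 \<Rightarrow> 'b::comm_ring_1" and s :: "nat \<Rightarrow> 'b"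
  assumes hom: "comm_ring_hom \<phi>"
begin

interpretation comm_ring_hom \<phi> by (fact hom)

lemma mpoly_eval_single:
  "mpoly_eval \<phi> s (Poly_Mapping.single \<mu> c) =
     \<phi> c * (\<Prod>j\<in>Poly_Mapping.keys \<mu>. s j ^ Poly_Mapping.lookup \<mu> j)"
  by (simp add: mpoly_eval_def zero)

lemma mpoly_eval_mconst: "mpoly_eval \<phi> s (mconst c) = \<phi> c"
  by (simp add: mconst_def mpoly_eval_single)

lemma mpoly_eval_mvar: "mpoly_eval \<phi> s (mvar i) = s i"
  by (simp add: mvar_def mpoly_eval_single one)

lemma mpoly_eval_add: "mpoly_eval \<phi> s (p + q) = mpoly_eval \<phi> s p + mpoly_eval \<phi> s q"
proof -
  let ?M = "\<lambda>\<mu>. \<Prod>j\<in>Poly_Mapping.keys \<mu>. s j ^ Poly_Mapping.lookup \<mu> j"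
  let ?K = "Poly_Mapping.keys p \<union> Poly_Mapping.keys q"
  \<comment> \<open>Cancellation can make the support of a sum smaller than the union of the
    supports; all three sums are therefore taken over the union, where extra terms vanish.\<close>
  have ext: "mpoly_eval \<phi> s r = (\<Sum>\<mu>\<in>?K. \<phi> (Poly_Mapping.lookup r \<mu>) * ?M \<mu>)"
    if "Poly_Mapping.keys r \<subseteq> ?K" for r
    unfolding mpoly_eval_def using that
    by (intro sum.mono_neutral_left) (auto simp: in_keys_iff zero)
  have "mpoly_eval \<phi> s (p + q) =
      (\<Sum>\<mu>\<in>?K. \<phi> (Poly_Mapping.lookup (p + q) \<mu>) * ?M \<mu>)"
    by (intro ext keys_add)
  then show ?thesis
    by (simp add: ext lookup_add add algebra_simps sum.distrib)
qed

lemma mpoly_eval_mult: "mpoly_eval \<phi> s (p * q) = mpoly_eval \<phi> s p * mpoly_eval \<phi> s q"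
proof (induction p rule: mpoly_additive_induct)
  case (add p p')
  then show ?case by (simp add: algebra_simps mpoly_eval_add)
next
  case (single \<mu> c)
  show ?case
  proof (induction q rule: mpoly_additive_induct)
    case (add q q')
    then show ?case by (simp add: algebra_simps mpoly_eval_add)
  next
    case (single \<nu> e)
    let ?J = "Poly_Mapping.keys \<mu> \<union> Poly_Mapping.keys \<nu>"
    have ext: "(\<Prod>j\<in>Poly_Mapping.keys \<kappa>. s j ^ Poly_Mapping.lookup \<kappa> j) =
        (\<Prod>j\<in>?J. s j ^ Poly_Mapping.lookup \<kappa> j)" if "Poly_Mapping.keys \<kappa> \<subseteq> ?J" for \<kappa>
      using that by (intro prod.mono_neutral_left) (auto simp: in_keys_iff)
    have "(\<Prod>j\<in>Poly_Mapping.keys (\<mu> + \<nu>). s j ^ Poly_Mapping.lookup (\<mu> + \<nu>) j) =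
        (\<Prod>j\<in>?J. s j ^ Poly_Mapping.lookup (\<mu> + \<nu>) j)"
      by (intro ext keys_add)
    then show ?case
      by (simp add: mult_single mpoly_eval_single mult ext lookup_add power_add prod.distrib
          algebra_simps)
  qed
qed

lemma comm_ring_hom_mpoly_eval: "comm_ring_hom (mpoly_eval \<phi> s)"
proof
  show "mpoly_eval \<phi> s 1 = 1"
    using mpoly_eval_mconst[of 1] by (simp add: mconst_def one)
qed (fact mpoly_eval_add mpoly_eval_mult)+

end

section \<open>Polynomials in a prescribed set of variables\<close>

lemma poly_in_vars_mconst: "poly_in_vars V (mconst c)"
  by (simp add: poly_in_vars_def mconst_def)

lemma poly_in_vars_mvar: "i \<in> V \<Longrightarrow> poly_in_vars V (mvar i)"
  by (simp add: poly_in_vars_def mvar_def)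

lemma poly_in_vars_0: "poly_in_vars V 0"
  by (simp add: poly_in_vars_def)

lemma poly_in_vars_1: "poly_in_vars V 1"
  by (simp add: poly_in_vars_def)

lemma poly_in_vars_add: "poly_in_vars V p \<Longrightarrow> poly_in_vars V q \<Longrightarrow> poly_in_vars V (p + q)"
  using keys_add[of p q] unfolding poly_in_vars_def by blast

lemma poly_in_vars_uminus: "poly_in_vars V p \<Longrightarrow> poly_in_vars V (- p)"
  by (simp add: poly_in_vars_def in_keys_iff)

lemma poly_in_vars_diff: "poly_in_vars V p \<Longrightarrow> poly_in_vars V q \<Longrightarrow> poly_in_vars V (p - q)"
  using poly_in_vars_add[OF _ poly_in_vars_uminus, of V p q] by simp

lemma poly_in_vars_mult:
  assumes "poly_in_vars V p" "poly_in_vars V q"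
  shows "poly_in_vars V (p * q)"
  unfolding poly_in_vars_def
proof
  fix \<kappa> assume "\<kappa> \<in> Poly_Mapping.keys (p * q)"
  then obtain \<mu> \<nu> where "\<mu> \<in> Poly_Mapping.keys p" "\<nu> \<in> Poly_Mapping.keys q" "\<kappa> = \<mu> + \<nu>"
    using keys_mult[of p q] by blast
  then show "Poly_Mapping.keys \<kappa> \<subseteq> V"
    using assms keys_add[of \<mu> \<nu>] unfolding poly_in_vars_def by blast
qed

lemma poly_in_vars_power: "poly_in_vars V p \<Longrightarrow> poly_in_vars V (p ^ k)"
  by (induction k) (simp_all add: poly_in_vars_1 poly_in_vars_mult)

lemma poly_in_vars_of_int: "poly_in_vars V (of_int k)"
  using poly_in_vars_mconst[of V "of_int k"]
  by (simp add: comm_ring_hom.of_int[OF comm_ring_hom_mconst])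

lemma poly_in_vars_sum: "(\<And>i. i \<in> A \<Longrightarrow> poly_in_vars V (f i)) \<Longrightarrow> poly_in_vars V (sum f A)"
  by (induction A rule: infinite_finite_induct) (auto intro: poly_in_vars_0 poly_in_vars_add)

lemmas poly_in_vars_intros = poly_in_vars_0 poly_in_vars_1 poly_in_vars_mconst poly_in_vars_mvar
  poly_in_vars_add poly_in_vars_uminus poly_in_vars_diff poly_in_vars_mult poly_in_vars_power
  poly_in_vars_of_int

lemma poly_in_vars_mono: "poly_in_vars V p \<Longrightarrow> V \<subseteq> W \<Longrightarrow> poly_in_vars W p"
  unfolding poly_in_vars_def by blast

section \<open>Polynomials viewed as univariate in one chosen variable\<close>

definition univ :: "nat \<Rightarrow> 'a::comm_ring_1 mpoly \<Rightarrow> 'a mpoly poly" where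
  "univ x = mpoly_eval (\<lambda>c. [:mconst c:]) (\<lambda>i. if i = x then [:0, 1:] else [:mvar i:])"

lemma comm_ring_hom_const_mconst: "comm_ring_hom (\<lambda>c. [:mconst c:])"
  by (intro comm_ring_hom_compose[OF comm_ring_hom_const_poly] comm_ring_hom_mconst)

lemma comm_ring_hom_univ: "comm_ring_hom (univ x)"
  unfolding univ_def by (intro comm_ring_hom_mpoly_eval comm_ring_hom_const_mconst)

lemma univ_mconst: "univ x (mconst c) = [:mconst c:]"
  by (simp add: univ_def mpoly_eval_mconst[OF comm_ring_hom_const_mconst])

lemma univ_mvar: "univ x (mvar i) = (if i = x then [:0, 1:] else [:mvar i:])"
  by (simp add: univ_def mpoly_eval_mvar[OF comm_ring_hom_const_mconst])

lemmas univ_add = comm_ring_hom.add[OF comm_ring_hom_univ]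
lemmas univ_mult = comm_ring_hom.mult[OF comm_ring_hom_univ]
lemmas univ_diff = comm_ring_hom.diff[OF comm_ring_hom_univ]
lemmas univ_0 = comm_ring_hom.zero[OF comm_ring_hom_univ]
lemmas univ_power = comm_ring_hom.power[OF comm_ring_hom_univ]

text \<open>Putting the variable back for the indeterminate undoes \<open>univ\<close>. Hence
  \<open>univ\<close> is injective and univariate facts can be pulled back.\<close>

lemma poly_univ: "poly (univ x p) (mvar x) = p"
  by (rule hom_mpoly_eqI[OF comm_ring_hom_compose[OF comm_ring_hom_poly comm_ring_hom_univ]
        comm_ring_hom_id _ _ poly_in_vars_UNIV])
    (simp_all add: univ_mconst univ_mvar)

lemma univ_eq_iff: "univ x p = univ x q \<longleftrightarrow> p = q"
  by (metis poly_univ)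

lemma univ_eq_0_iff: "univ x p = 0 \<longleftrightarrow> p = 0"
  by (metis univ_eq_iff univ_0)

lemma univ_free: "poly_in_vars V p \<Longrightarrow> x \<notin> V \<Longrightarrow> univ x p = [:p:]"
  by (rule hom_mpoly_eqI[OF comm_ring_hom_univ comm_ring_hom_const_poly])
    (auto simp: univ_mconst univ_mvar)

text \<open>The coefficient type still contains \<open>mvar x\<close>; that the coefficients avoid
  it has to be proved.\<close>

lemma poly_in_vars_coeff_univ:
  "poly_in_vars V p \<Longrightarrow> poly_in_vars (V - {x}) (coeff (univ x p) k)"
proof (induction arbitrary: k rule: poly_in_vars_induct)
  case (mult p q)
  then show ?case
    by (auto simp: univ_mult coeff_mult intro!: poly_in_vars_sum poly_in_vars_mult)
qed (auto simp: univ_mconst univ_mvar univ_add coeff_pCons split: nat.split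
      intro!: poly_in_vars_intros)

lemma lookup_coeff_univ:
  "Poly_Mapping.lookup (coeff (univ x p) k) \<nu> =
     (if Poly_Mapping.lookup \<nu> x = 0 then Poly_Mapping.lookup p (\<nu> + Poly_Mapping.single x k) else 0)"
proof (induction p rule: mpoly_additive_induct)
  case (add p q)
  then show ?case by (simp add: univ_add lookup_add)
next
  case (single \<mu> c)
  \<comment> \<open>The monomial is split into \<open>?\<mu>\<close>, its part free of
    \<open>x\<close>, and the power \<open>?l\<close> of \<open>x\<close>.\<close>
  let ?l = "Poly_Mapping.lookup \<mu> x" and ?\<mu> = "Poly_Mapping.update x 0 \<mu>"
  have \<mu>: "?\<mu> + Poly_Mapping.single x ?l = \<mu>"
    by (rule poly_mapping_eqI) (simp add: lookup_add lookup_update lookup_single when_def)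
  have "Poly_Mapping.single \<mu> c = Poly_Mapping.single ?\<mu> c * mvar x ^ ?l"
  proof -
    have "mvar x ^ j = (Poly_Mapping.single (Poly_Mapping.single x j) 1 :: 'a mpoly)" for j
      by (induction j) (simp_all add: mvar_def mult_single single_add[symmetric])
    then show ?thesis by (simp add: mult_single \<mu>)
  qed
  moreover have "univ x (Poly_Mapping.single ?\<mu> c) = [:Poly_Mapping.single ?\<mu> c:]"
    by (rule univ_free[of "- {x}"])
      (auto simp: poly_in_vars_def in_keys_iff lookup_update split: if_splits)
  ultimately have "univ x (Poly_Mapping.single \<mu> c) = monom (Poly_Mapping.single ?\<mu> c) ?l"
    by (simp add: univ_mult univ_power univ_mvar monom_altdef)
  moreover have "Poly_Mapping.lookup (Poly_Mapping.single ?\<mu> c) \<nu> =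
      (if Poly_Mapping.lookup \<nu> x = 0
       then Poly_Mapping.lookup (Poly_Mapping.single \<mu> c) (\<nu> + Poly_Mapping.single x ?l) else 0)"
  proof -
    have "?\<mu> = \<nu> \<longleftrightarrow> Poly_Mapping.lookup \<nu> x = 0 \<and> \<mu> = \<nu> + Poly_Mapping.single x ?l"
    proof
      assume "?\<mu> = \<nu>"
      then show "Poly_Mapping.lookup \<nu> x = 0 \<and> \<mu> = \<nu> + Poly_Mapping.single x ?l"
        using \<mu> by (auto simp: lookup_update)
    next
      assume "Poly_Mapping.lookup \<nu> x = 0 \<and> \<mu> = \<nu> + Poly_Mapping.single x ?l"
      then show "?\<mu> = \<nu>" using \<mu> by (metis add_right_cancel)
    qed
    then show ?thesis by (auto simp: lookup_single when_def)
  qed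
  moreover have "Poly_Mapping.lookup (Poly_Mapping.single \<mu> c) (\<nu> + Poly_Mapping.single x k) = 0"
    if "?l \<noteq> k" "Poly_Mapping.lookup \<nu> x = 0"
    using that by (auto simp: lookup_single when_def lookup_add)
  ultimately show ?case
    by auto
qed

text \<open>Monomials with the same exponent of \<open>x\<close> stay distinct when that exponent is
  erased, so the top power of \<open>x\<close> keeps a nonzero coefficient. Through this,
  \<open>deg_var\<close> inherits the additivity of \<open>degree\<close>.\<close>

lemma degree_univ: "degree (univ x p) = deg_var x p"
proof (rule antisym)
  have fin: "finite (insert 0 ((\<lambda>\<mu>. Poly_Mapping.lookup \<mu> x) ` Poly_Mapping.keys p))"
    by simp
  show "degree (univ x p) \<le> deg_var x p"
  proof (rule degree_le, intro allI impI poly_mapping_eqI)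
    fix k \<nu> assume k: "deg_var x p < k"
    have "\<nu> + Poly_Mapping.single x k \<notin> Poly_Mapping.keys p" if "Poly_Mapping.lookup \<nu> x = 0"
    proof
      assume "\<nu> + Poly_Mapping.single x k \<in> Poly_Mapping.keys p"
      then have "Poly_Mapping.lookup (\<nu> + Poly_Mapping.single x k) x \<le> deg_var x p"
        unfolding deg_var_def by (intro Max_ge[OF fin]) blast
      then show False using k that by (simp add: lookup_add)
    qed
    then show "Poly_Mapping.lookup (coeff (univ x p) k) \<nu> = Poly_Mapping.lookup 0 \<nu>"
      by (simp add: lookup_coeff_univ in_keys_iff)
  qed
  have "Poly_Mapping.lookup \<mu> x \<le> degree (univ x p)" if \<mu>: "\<mu> \<in> Poly_Mapping.keys p" for \<mu>
  proof (rule le_degree)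
    let ?\<mu> = "Poly_Mapping.update x 0 \<mu>"
    have "?\<mu> + Poly_Mapping.single x (Poly_Mapping.lookup \<mu> x) = \<mu>"
      by (rule poly_mapping_eqI) (simp add: lookup_add lookup_update lookup_single when_def)
    then have "Poly_Mapping.lookup (coeff (univ x p) (Poly_Mapping.lookup \<mu> x)) ?\<mu> \<noteq> 0"
      using \<mu> by (simp add: lookup_coeff_univ lookup_update in_keys_iff)
    then show "coeff (univ x p) (Poly_Mapping.lookup \<mu> x) \<noteq> 0"
      by auto
  qed
  then show "deg_var x p \<le> degree (univ x p)"
    unfolding deg_var_def by (subst Max_le_iff[OF fin]) auto
qed

section \<open>Irreducible polynomials are prime\<close>

lemma deg_var_mult:
  fixes p q :: "'a::idom mpoly"
  assumes "p \<noteq> 0" "q \<noteq> 0"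
  shows "deg_var i (p * q) = deg_var i p + deg_var i q"
  using assms by (simp flip: degree_univ add: univ_mult degree_mult_eq univ_eq_0_iff)

lemma deg_var_eq_0_iff: "deg_var i p = 0 \<longleftrightarrow> poly_in_vars (- {i}) p"
proof -
  have fin: "finite (insert 0 ((\<lambda>\<mu>. Poly_Mapping.lookup \<mu> i) ` Poly_Mapping.keys p))"
    by simp
  have "deg_var i p \<le> 0 \<longleftrightarrow> poly_in_vars (- {i}) p"
    unfolding deg_var_def by (subst Max_le_iff[OF fin]) (auto simp: poly_in_vars_def in_keys_iff)
  then show ?thesis by simp
qed

lemma poly_in_vars_iff_deg_var: "poly_in_vars V p \<longleftrightarrow> (\<forall>i. i \<notin> V \<longrightarrow> deg_var i p = 0)"
  by (auto simp: deg_var_eq_0_iff poly_in_vars_def subset_iff)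

lemma poly_in_vars_deg_var_0:
  assumes "poly_in_vars (insert x W) p" "deg_var x p = 0"
  shows "poly_in_vars W p"
  using assms unfolding poly_in_vars_iff_deg_var by (metis insert_iff)

lemma deg_var_free: "poly_in_vars W p \<Longrightarrow> x \<notin> W \<Longrightarrow> deg_var x p = 0"
  by (simp add: poly_in_vars_iff_deg_var)

text \<open>Degrees add over an integral domain, so a variable that is absent from a nonzero product
  is absent from both factors.\<close>

lemma poly_in_vars_factor:
  fixes p q :: "'a::idom mpoly"
  assumes "poly_in_vars V (p * q)" "p * q \<noteq> 0"
  shows "poly_in_vars V p" "poly_in_vars V q"
  using assms by (auto simp: poly_in_vars_iff_deg_var deg_var_mult)

lemma poly_in_vars_dvd:
  fixes p q :: "'a::idom mpoly"
  assumes "p dvd q" "poly_in_vars V q" "q \<noteq> 0"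
  shows "poly_in_vars V p"
  using assms by (auto elim!: dvdE intro: poly_in_vars_factor)

lemma poly_in_vars_empty:
  assumes "poly_in_vars {} p"
  obtains c where "p = mconst c"
proof -
  have "\<exists>c. p = mconst c"
    using assms
  proof (induction rule: poly_in_vars_induct)
    case (add p q)
    then show ?case by (metis comm_ring_hom.add[OF comm_ring_hom_mconst])
  next
    case (mult p q)
    then show ?case by (metis comm_ring_hom.mult[OF comm_ring_hom_mconst])
  qed auto
  then show ?thesis using that by blast
qed

lemma is_unit_if_poly_in_vars_empty:
  fixes p :: "'a::field mpoly"
  assumes "poly_in_vars {} p" "p \<noteq> 0"
  shows "p dvd 1"
proof -
  obtain c where c: "p = mconst c"
    using assms(1) by (rule poly_in_vars_empty)
  then have "c \<noteq> 0"
    using assms(2) by (auto simp: comm_ring_hom.zero[OF comm_ring_hom_mconst])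
  then have "p * mconst (inverse c) = 1"
    by (simp add: c flip: comm_ring_hom.mult[OF comm_ring_hom_mconst]
        comm_ring_hom.one[OF comm_ring_hom_mconst])
  then show ?thesis by (metis dvd_triv_left)
qed

lemma deg_var_unit:
  fixes p :: "'a::idom mpoly"
  assumes "p dvd 1"
  shows "deg_var i p = 0"
proof -
  have "poly_in_vars {} p"
    using poly_in_vars_dvd[OF assms poly_in_vars_1] by simp
  then show ?thesis by (simp add: poly_in_vars_iff_deg_var)
qed

text \<open>Supplies the measure for inductions over factorizations: over a field a non-unit factor
  involves some variable, so removing it lowers the total of the degrees.\<close>

lemma sum_deg_var_factor_less:
  fixes p q :: "'a::field mpoly"
  assumes "finite W" "poly_in_vars W q" "p \<noteq> 0" "q \<noteq> 0" "\<not> q dvd 1"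
  shows "(\<Sum>i\<in>W. deg_var i p) < (\<Sum>i\<in>W. deg_var i (p * q))"
proof -
  have "\<not> poly_in_vars {} q"
    using is_unit_if_poly_in_vars_empty assms by blast
  then obtain i where "i \<in> W" "deg_var i q > 0"
    using assms(2) unfolding poly_in_vars_iff_deg_var by blast
  then have "(\<Sum>i\<in>W. deg_var i q) > 0"
    using assms(1) by (intro sum_pos2[where i = i]) auto
  then show ?thesis
    using assms by (simp add: deg_var_mult sum.distrib)
qed

lemma exists_irreducible_factor:
  fixes p :: "'a::field mpoly"
  assumes "finite W" "poly_in_vars W p" "p \<noteq> 0" "\<not> p dvd 1"
  shows "\<exists>q. irreducible q \<and> q dvd p"
  using assms(2-)
proof (induction "\<Sum>i\<in>W. deg_var i p" arbitrary: p rule: less_induct)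
  case less
  show ?case
  proof (cases "irreducible p")
    case False
    then obtain a b where ab: "p = a * b" "\<not> a dvd 1" "\<not> b dvd 1"
      using less.prems by (auto simp: irreducible_def)
    then have nz: "a \<noteq> 0" "b \<noteq> 0"
      using less.prems by auto
    have W: "poly_in_vars W a" "poly_in_vars W b"
      using poly_in_vars_factor[of W a b] less.prems(1,2) by (simp_all flip: ab(1))
    then have "(\<Sum>i\<in>W. deg_var i a) < (\<Sum>i\<in>W. deg_var i p)"
      using sum_deg_var_factor_less[OF assms(1) W(2) nz ab(3)] by (simp flip: ab(1))
    then show ?thesis
      using less.hyps[OF _ W(1) nz(1) ab(2)] unfolding ab(1) by (blast intro: dvd_mult2)
  qed auto
qed

text \<open>Primality is stated relative to \<open>V\<close> so that it can be proved by induction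
  on the variables; the type argument merely fixes the coefficient field.\<close>

definition irreducibles_prime_in :: "nat set \<Rightarrow> 'a::field itself \<Rightarrow> bool" where
  "irreducibles_prime_in V _ \<longleftrightarrow> (\<forall>d p q :: 'a mpoly. irreducible d \<longrightarrow>
     poly_in_vars V d \<longrightarrow> poly_in_vars V p \<longrightarrow> poly_in_vars V q \<longrightarrow>
     d dvd p * q \<longrightarrow> d dvd p \<or> d dvd q)"

text \<open>A polynomial free of \<open>x\<close> is a constant of the univariate ring, where
  divisibility by a constant is coefficientwise.\<close>

lemma dvd_iff_dvd_coeff_univ:
  fixes p d :: "'a::idom mpoly"
  assumes "poly_in_vars W d" "x \<notin> W"
  shows "d dvd p \<longleftrightarrow> (\<forall>i. d dvd coeff (univ x p) i)"
proof
  assume "d dvd p"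
  then obtain r where "p = d * r" ..
  then show "\<forall>i. d dvd coeff (univ x p) i"
    by (simp add: univ_mult univ_free[OF assms])
next
  assume "\<forall>i. d dvd coeff (univ x p) i"
  then have "[:d:] dvd univ x p"
    by (simp add: const_poly_dvd_iff)
  then obtain r where "univ x p = [:d:] * r" ..
  then have "p = d * poly r (mvar x)"
    using poly_univ[of x p] by simp
  then show "d dvd p" by simp
qed

text \<open>Gauss's argument: if \<open>i\<close> and \<open>j\<close> are the least indices of
  coefficients of \<open>p\<close> and \<open>q\<close> not divisible by \<open>d\<close>, then in
  the coefficient of index \<open>i + j\<close> of the product all terms but one are divisible by
  \<open>d\<close>, and primality in \<open>W\<close> applies to the remaining term.\<close>

lemma irreducible_prime_lift:
  fixes d p q :: "'a::field mpoly"
  assumes W: "irreducibles_prime_in W TYPE('a)" "x \<notin> W"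
    and d: "irreducible d" "poly_in_vars W d"
    and pq: "poly_in_vars (insert x W) p" "poly_in_vars (insert x W) q"
    and dvd: "d dvd p * q"
  shows "d dvd p \<or> d dvd q"
proof (rule ccontr)
  assume "\<not> (d dvd p \<or> d dvd q)"
  then have ex: "\<exists>i. \<not> d dvd coeff (univ x p) i" "\<exists>j. \<not> d dvd coeff (univ x q) j"
    using dvd_iff_dvd_coeff_univ[OF d(2) W(2), of p] dvd_iff_dvd_coeff_univ[OF d(2) W(2), of q]
    by blast+
  obtain i where i: "\<not> d dvd coeff (univ x p) i" "\<And>k. k < i \<Longrightarrow> d dvd coeff (univ x p) k"
    using ex(1) exists_least_iff[of "\<lambda>i. \<not> d dvd coeff (univ x p) i"] by blast
  obtain j where j: "\<not> d dvd coeff (univ x q) j" "\<And>k. k < j \<Longrightarrow> d dvd coeff (univ x q) k"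
    using ex(2) exists_least_iff[of "\<lambda>j. \<not> d dvd coeff (univ x q) j"] by blast
  let ?t = "\<lambda>k. coeff (univ x p) k * coeff (univ x q) (i + j - k)"
  have "coeff (univ x (p * q)) (i + j) = (\<Sum>k\<le>i + j. ?t k)"
    by (simp add: univ_mult coeff_mult)
  also have "\<dots> = ?t i + (\<Sum>k\<in>{..i + j} - {i}. ?t k)"
    by (subst sum.remove[of _ i]) auto
  finally have eq: "coeff (univ x (p * q)) (i + j) = ?t i + (\<Sum>k\<in>{..i + j} - {i}. ?t k)" .
  have "d dvd ?t k" if "k \<in> {..i + j} - {i}" for k
  proof (cases "k < i")
    case False
    then have "i + j - k < j" using that by auto
    then show ?thesis using j(2) by auto
  qed (simp add: i(2))
  then have "d dvd (\<Sum>k\<in>{..i + j} - {i}. ?t k)"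
    by (rule dvd_sum)
  moreover have "d dvd coeff (univ x (p * q)) (i + j)"
    using dvd dvd_iff_dvd_coeff_univ[OF d(2) W(2)] by blast
  ultimately have "d dvd ?t i"
    unfolding eq by (simp add: dvd_add_left_iff)
  moreover have "insert x W - {x} = W"
    using W(2) by auto
  then have "poly_in_vars W (coeff (univ x p) i)" "poly_in_vars W (coeff (univ x q) j)"
    using poly_in_vars_coeff_univ[OF pq(1), of x] poly_in_vars_coeff_univ[OF pq(2), of x] by simp_all
  ultimately have "d dvd coeff (univ x p) i \<or> d dvd coeff (univ x q) j"
    using W(1) d by (simp add: irreducibles_prime_in_def)
  then show False using i(1) j(1) by blast
qed

text \<open>Stands in for Gauss's lemma: it clears denominators free of \<open>x\<close> from factorizations in \<open>x\<close>.\<close>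

lemma free_divisor_split:
  fixes c g h :: "'a::field mpoly"
  assumes W: "finite W" "irreducibles_prime_in W TYPE('a)" "x \<notin> W"
    and "poly_in_vars W c" "c \<noteq> 0"
    and "poly_in_vars (insert x W) g" "poly_in_vars (insert x W) h" "c dvd g * h"
  shows "\<exists>s t. c = s * t \<and> s dvd g \<and> t dvd h"
  using assms(4-)
proof (induction "\<Sum>i\<in>W. deg_var i c" arbitrary: c g h rule: less_induct)
  case less
  show ?case
  proof (cases "c dvd 1")
    case True
    then have "c dvd g" by (rule dvd_trans) simp
    then show ?thesis by (intro exI[of _ c] exI[of _ 1]) simp
  next
    case False
    then obtain p where p: "irreducible p" "p dvd c"
      using exists_irreducible_factor[OF W(1) less.prems(1,2)] by blast
    then obtain c1 where c1: "c = c1 * p" by (metis dvdE mult.commute)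
    then have nz: "c1 \<noteq> 0" "p \<noteq> 0" using less.prems by auto
    have piv: "poly_in_vars W c1" "poly_in_vars W p"
      using poly_in_vars_factor[of W c1 p] less.prems(1,2) by (simp_all flip: c1)
    have less': "(\<Sum>i\<in>W. deg_var i c1) < (\<Sum>i\<in>W. deg_var i c)"
      unfolding c1 using W(1) piv nz p(1) by (intro sum_deg_var_factor_less) (auto simp: irreducible_def)
    have "p dvd g * h" using p(2) less.prems(5) by (rule dvd_trans)
    \<comment> \<open>The irreducible factor \<open>p\<close> of \<open>c\<close> is assigned to
      \<open>s\<close> or to \<open>t\<close> according to which of \<open>g\<close> and
      \<open>h\<close> it divides; the induction then treats the cofactor \<open>c1\<close>.\<close>
    then consider "p dvd g" | "p dvd h"
      using irreducible_prime_lift[OF W(2,3) p(1) piv(2)] less.prems by blast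
    then show ?thesis
    proof cases
      case 1
      then obtain g1 where g1: "g = p * g1" ..
      then have "poly_in_vars (insert x W) g1"
        using poly_in_vars_factor(2)[of "insert x W" p g1] less.prems nz
        by (cases "g1 = 0") (auto simp: poly_in_vars_0)
      moreover have "c1 dvd g1 * h"
        using less.prems(5) nz by (simp add: c1 g1 mult.commute[of c1] mult.assoc)
      ultimately obtain s t where "c1 = s * t" "s dvd g1" "t dvd h"
        using less.hyps[OF less' piv(1) nz(1) _ less.prems(4)] by blast
      then have "c = (p * s) * t" "p * s dvd g"  "t dvd h"
        by (simp_all add: c1 g1 mult_ac)
      then show ?thesis by blast
    next
      case 2
      then obtain h1 where h1: "h = p * h1" ..
      then have "poly_in_vars (insert x W) h1"
        using poly_in_vars_factor(2)[of "insert x W" p h1] less.prems nz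
        by (cases "h1 = 0") (auto simp: poly_in_vars_0)
      moreover have "c1 dvd g * h1"
        using less.prems(5) nz by (simp add: c1 h1 mult.commute[of c1] mult.left_commute[of g])
      ultimately obtain s t where "c1 = s * t" "s dvd g" "t dvd h1"
        using less.hyps[OF less' piv(1) nz(1) less.prems(3)] by blast
      then have "c = s * (p * t)" "s dvd g"  "p * t dvd h"
        by (simp_all add: c1 h1 mult_ac)
      then show ?thesis by blast
    qed
  qed
qed

text \<open>Division with remainder over the fraction field of the coefficients, kept free of
  denominators: the multiplier \<open>c\<close> collects leading coefficients of
  \<open>g\<close>.\<close>

lemma mpoly_pseudo_division:
  fixes g p :: "'a::idom mpoly"
  assumes x: "x \<notin> W" and g: "g \<noteq> 0" "poly_in_vars (insert x W) g"
    and p: "poly_in_vars (insert x W) p"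
  shows "\<exists>c q r. poly_in_vars W c \<and> c \<noteq> 0 \<and> poly_in_vars (insert x W) q \<and>
    poly_in_vars (insert x W) r \<and> c * p = g * q + r \<and> (r = 0 \<or> deg_var x r < deg_var x g)"
proof -
  have Wx: "insert x W - {x} = W"
    using x by auto
  have up: "poly_in_vars (insert x W) r" if "poly_in_vars W r" for r :: "'a mpoly"
    using poly_in_vars_mono[OF that] by blast
  \<comment> \<open>The zero polynomial has \<open>deg_var\<close> equal to 0, so the case
    \<open>p = 0\<close> is listed separately; bound 0 then means exactly
    \<open>p = 0\<close>.\<close>
  have "\<exists>c q r. poly_in_vars W c \<and> c \<noteq> 0 \<and> poly_in_vars (insert x W) q \<and>
      poly_in_vars (insert x W) r \<and> c * p = g * q + r \<and> (r = 0 \<or> deg_var x r < deg_var x g)"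
    if "p = 0 \<or> deg_var x p < n" for n
    using p that
  proof (induction n arbitrary: p)
    case 0
    then show ?case
      by (intro exI[of _ 1] exI[of _ 0]) (auto intro: poly_in_vars_intros)
  next
    case (Suc n)
    consider "p = 0 \<or> deg_var x p < n" | "p = 0 \<or> deg_var x p < deg_var x g"
      | "p \<noteq> 0" "deg_var x p = n" "deg_var x g \<le> n"
      using Suc.prems by linarith
    then show ?case
    proof cases
      case 1
      then show ?thesis using Suc by blast
    next
      case 2
      then show ?thesis using Suc.prems
        by (intro exI[of _ 1] exI[of _ 0] exI[of _ p]) (auto intro: poly_in_vars_intros)
    next
      case 3
      define lg where "lg = lead_coeff (univ x g)"
      define lp where "lp = lead_coeff (univ x p)"
      define k where "k = n - deg_var x g"
      have lg: "poly_in_vars W lg" "lg \<noteq> 0" and lp: "poly_in_vars W lp"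
        using poly_in_vars_coeff_univ[OF g(2), of x] poly_in_vars_coeff_univ[OF Suc.prems(1), of x] g
        by (simp_all add: lg_def lp_def Wx univ_eq_0_iff)
      \<comment> \<open>Multiplying by \<open>lg\<close> instead of dividing by it makes the two
        terms of degree \<open>n\<close> cancel.\<close>
      define p' where "p' = lg * p - lp * mvar x ^ k * g"
      have p': "poly_in_vars (insert x W) p'"
        unfolding p'_def using lg lp up Suc.prems g by (intro poly_in_vars_intros) auto
      have u: "univ x p' = smult lg (univ x p) - monom lp k * univ x g"
        using x by (simp add: p'_def univ_diff univ_mult univ_power univ_mvar monom_altdef
            univ_free[OF lg(1)] univ_free[OF lp])
      have "degree (monom lp k * univ x g) \<le> n"
        using 3 degree_monom_le[of lp k]
        by (intro order.trans[OF degree_mult_le]) (simp add: k_def degree_univ)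
      then have "degree (univ x p') \<le> n"
        unfolding u using 3 by (intro degree_diff_le) (auto simp: degree_univ)
      moreover have "coeff (univ x p') n = 0"
        using 3 by (simp add: u coeff_monom_mult k_def lg_def lp_def degree_univ
            mult.commute[of "coeff (univ x g) (deg_var x g)"])
      ultimately have "univ x p' = 0 \<or> degree (univ x p') < n"
        by (metis eq_zero_or_degree_less)
      then have "p' = 0 \<or> deg_var x p' < n"
        by (simp add: univ_eq_0_iff degree_univ)
      from Suc.IH[OF p' this] obtain c q r where
        cqr: "poly_in_vars W c" "c \<noteq> 0" "poly_in_vars (insert x W) q" "poly_in_vars (insert x W) r"
          "c * p' = g * q + r" "r = 0 \<or> deg_var x r < deg_var x g"
        by blast
      have "(c * lg) * p = g * (q + c * lp * mvar x ^ k) + r"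
        using cqr(5) by (simp add: p'_def algebra_simps)
      moreover have "poly_in_vars W (c * lg)" "c * lg \<noteq> 0"
        using cqr lg by (auto intro: poly_in_vars_intros)
      moreover have "poly_in_vars (insert x W) (q + c * lp * mvar x ^ k)"
        using cqr lp up by (intro poly_in_vars_intros) auto
      ultimately show ?thesis using cqr(4,6) by blast
    qed
  qed
  from this[of "Suc (deg_var x p)"] show ?thesis by simp
qed

text \<open>The factor \<open>w\<close> of \<open>d * y\<close> splits into a part \<open>s\<close>
  of \<open>d\<close> and a part of \<open>y\<close>. Since \<open>s\<close> is free of
  \<open>x\<close> while the irreducible \<open>d\<close> has positive degree in \<open>x\<close>,
  \<open>s\<close> is a unit, and cancelling leaves \<open>d\<close> dividing
  \<open>q\<close>.\<close>

lemma irreducible_dvd_free_mult: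
  fixes d q w :: "'a::field mpoly"
  assumes W: "finite W" "irreducibles_prime_in W TYPE('a)" "x \<notin> W"
    and d: "irreducible d" "poly_in_vars (insert x W) d" "deg_var x d > 0"
    and q: "poly_in_vars (insert x W) q"
    and w: "poly_in_vars W w" "w \<noteq> 0" and dvd: "d dvd w * q"
  shows "d dvd q"
proof (cases "q = 0")
  case False
  from dvd obtain y where y: "w * q = d * y" ..
  have w': "poly_in_vars (insert x W) w"
    using poly_in_vars_mono[OF w(1)] by blast
  then have "poly_in_vars (insert x W) (d * y)" "d * y \<noteq> 0"
    using q w False by (auto simp flip: y intro: poly_in_vars_mult)
  then have "poly_in_vars (insert x W) y"
    by (rule poly_in_vars_factor)
  moreover have "w dvd d * y" by (simp flip: y)
  ultimately obtain s t where st: "w = s * t" "s dvd d" "t dvd y"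
    using free_divisor_split[OF W w d(2)] by blast
  then obtain d1 y1 where d1: "d = s * d1" and y1: "y = t * y1" by (auto elim!: dvdE)
  have "q = d1 * y1"
    using y w(2) by (auto simp: st d1 y1 algebra_simps)
  have nz: "s \<noteq> 0" "d1 \<noteq> 0" "t \<noteq> 0" using d1 d(3) st w(2) by (auto simp: deg_var_def)
  have "deg_var x s = 0"
    using deg_var_free[OF w(1) W(3)] st(1) nz by (simp add: deg_var_mult)
  then have "deg_var x d1 > 0"
    using d(3) nz by (simp add: d1 deg_var_mult)
  then have "\<not> d1 dvd 1" using deg_var_unit by fastforce
  then have "s dvd 1"
    using d(1) d1 by (auto simp: irreducible_def)
  then have "d dvd d1"
    by (simp add: d1 mult_unit_dvd_iff')
  then show ?thesis by (simp add: \<open>q = d1 * y1\<close>)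
qed simp

text \<open>Euclid's argument with denominators cleared: a nonzero element \<open>g\<close> of least
  degree in the ideal of \<open>q\<close> and \<open>d\<close> divides every element up to a
  multiplier free of \<open>x\<close>. Positive degree of \<open>g\<close> would make
  \<open>d\<close> divide \<open>g\<close> and then \<open>q\<close>.\<close>

lemma irreducible_bezout:
  fixes d q :: "'a::field mpoly"
  assumes W: "finite W" "irreducibles_prime_in W TYPE('a)" "x \<notin> W"
    and d: "irreducible d" "poly_in_vars (insert x W) d" "deg_var x d > 0"
    and q: "poly_in_vars (insert x W) q" "\<not> d dvd q"
  shows "\<exists>u v w. poly_in_vars (insert x W) u \<and> poly_in_vars (insert x W) v \<and>
    poly_in_vars W w \<and> w \<noteq> 0 \<and> u * q + v * d = w"
proof -
  define S where "S = {g. g \<noteq> 0 \<and> (\<exists>u v. poly_in_vars (insert x W) u \<and>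
    poly_in_vars (insert x W) v \<and> g = u * q + v * d)}"
  have nz: "d \<noteq> 0" "q \<noteq> 0" using d(3) q(2) by (auto simp: deg_var_def)
  have dS: "d \<in> S"
    unfolding S_def using nz(1)
    by (intro CollectI conjI exI[of _ 0] exI[of _ 1]) (simp_all add: poly_in_vars_intros)
  have qS: "q \<in> S"
    unfolding S_def using nz(2)
    by (intro CollectI conjI exI[of _ 1] exI[of _ 0]) (simp_all add: poly_in_vars_intros)
  obtain g where g: "g \<in> S" and min: "\<And>p. p \<in> S \<Longrightarrow> deg_var x g \<le> deg_var x p"
    using ex_has_least_nat[of "\<lambda>p. p \<in> S", OF dS, of "deg_var x"] by blast
  from g obtain u v where uv: "poly_in_vars (insert x W) u" "poly_in_vars (insert x W) v"
      "g = u * q + v * d" and g0: "g \<noteq> 0"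
    unfolding S_def by blast
  have gV: "poly_in_vars (insert x W) g"
    unfolding uv(3) using uv d q by (intro poly_in_vars_intros)
  have up: "poly_in_vars (insert x W) r" if "poly_in_vars W r" for r :: "'a mpoly"
    using poly_in_vars_mono[OF that] by blast
  \<comment> \<open>The pseudo-remainder stays in the ideal, so minimality of \<open>g\<close>
    forces it to be zero.\<close>
  have divides: "\<exists>c h. poly_in_vars W c \<and> c \<noteq> 0 \<and> poly_in_vars (insert x W) h \<and> c * p = g * h"
    if p: "p \<in> S" for p
  proof -
    from p obtain u' v' where uv': "poly_in_vars (insert x W) u'" "poly_in_vars (insert x W) v'"
        "p = u' * q + v' * d"
      unfolding S_def by blast
    have "poly_in_vars (insert x W) p"
      unfolding uv'(3) using uv' d q by (intro poly_in_vars_intros)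
    from mpoly_pseudo_division[OF W(3) g0 gV this] obtain c h r where
      chr: "poly_in_vars W c" "c \<noteq> 0" "poly_in_vars (insert x W) h" "c * p = g * h + r"
        "r = 0 \<or> deg_var x r < deg_var x g"
      by blast
    have "r = (c * u' - h * u) * q + (c * v' - h * v) * d"
      using chr(4) unfolding uv(3) uv'(3) by (simp add: algebra_simps)
    moreover have "poly_in_vars (insert x W) (c * u' - h * u)"
        "poly_in_vars (insert x W) (c * v' - h * v)"
      using chr up uv uv' by (auto intro!: poly_in_vars_intros)
    ultimately have "r = 0 \<or> r \<in> S"
      unfolding S_def by blast
    then have "r = 0" using chr(5) min by force
    then show ?thesis using chr by auto
  qed
  have "deg_var x g = 0"
  proof (rule ccontr)
    assume deg: "deg_var x g \<noteq> 0"
    obtain c h where ch: "poly_in_vars W c" "c \<noteq> 0" "poly_in_vars (insert x W) h" "c * d = g * h"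
      using divides[OF dS] by blast
    then have "c dvd g * h" by (metis dvd_triv_left)
    then obtain s t where st: "c = s * t" "s dvd g" "t dvd h"
      using free_divisor_split[OF W ch(1,2) gV ch(3)] by blast
    then obtain g1 h1 where g1: "g = s * g1" and h1: "h = t * h1" by (auto elim!: dvdE)
    \<comment> \<open>Once the multiplier is cancelled, \<open>g1\<close> carries the whole degree
      of \<open>g\<close>; it is not a unit, so irreducibility makes \<open>h1\<close> one and
      \<open>d\<close> an associate of \<open>g1\<close>.\<close>
    have d_eq: "d = g1 * h1"
      using ch(2,4) by (auto simp: st g1 h1 algebra_simps)
    have nz': "s \<noteq> 0" "g1 \<noteq> 0" "t \<noteq> 0" using g1 g0 st ch(2) by auto
    have "deg_var x s = 0"
      using deg_var_free[OF ch(1) W(3)] st(1) nz' by (simp add: deg_var_mult)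
    then have "deg_var x g1 \<noteq> 0"
      using deg nz' by (simp add: g1 deg_var_mult)
    then have "\<not> g1 dvd 1" using deg_var_unit by fastforce
    then have "h1 dvd 1"
      using d(1) d_eq by (auto simp: irreducible_def)
    then have "d dvd g"
      by (simp add: d_eq g1 mult_unit_dvd_iff)
    moreover obtain c' h' where "poly_in_vars W c'" "c' \<noteq> 0" "c' * q = g * h'"
      using divides[OF qS] by blast
    ultimately have "d dvd q"
      using irreducible_dvd_free_mult[OF W d q(1), of c'] by simp
    then show False using q(2) by blast
  qed
  then have "poly_in_vars W g"
    by (rule poly_in_vars_deg_var_0[OF gV])
  then show ?thesis using uv g0 by blast
qed

text \<open>Induction on the variables. If \<open>d\<close> is free of the new variable, Gauss's
  argument applies; otherwise the Bezout identity does. Without variables every nonzero polynomial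
  is a unit.\<close>

lemma irreducibles_prime_in_finite:
  assumes "finite V"
  shows "irreducibles_prime_in V TYPE('a::field)"
  using assms
proof (induction V rule: finite_induct)
  case empty
  show ?case
    using is_unit_if_poly_in_vars_empty
    by (auto simp: irreducibles_prime_in_def irreducible_def)
next
  case (insert x W)
  show ?case
    unfolding irreducibles_prime_in_def
  proof (intro allI impI)
    fix d p q :: "'a mpoly"
    assume d: "irreducible d" "poly_in_vars (insert x W) d"
      and p: "poly_in_vars (insert x W) p" and q: "poly_in_vars (insert x W) q"
      and dvd: "d dvd p * q"
    show "d dvd p \<or> d dvd q"
    proof (cases "deg_var x d = 0")
      case True
      then have "poly_in_vars W d"
        by (rule poly_in_vars_deg_var_0[OF d(2)])
      then show ?thesis
        using irreducible_prime_lift[OF insert.IH insert.hyps(2) d(1) _ p q dvd] by blast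
    next
      case False
      show ?thesis
      proof (rule ccontr)
        assume "\<not> (d dvd p \<or> d dvd q)"
        then have "\<not> d dvd q" "\<not> d dvd p" by blast+
        then obtain u v w where uvw: "poly_in_vars W w" "w \<noteq> 0" "u * p + v * d = w"
          using irreducible_bezout[OF insert.hyps(1) insert.IH insert.hyps(2) d _ p] False by blast
        \<comment> \<open>The Bezout identity times \<open>q\<close>: both summands on the right are
          divisible by \<open>d\<close>.\<close>
        have "w * q = u * (p * q) + d * (v * q)"
          by (simp flip: uvw(3) add: algebra_simps)
        then have "d dvd w * q" using dvd by simp
        then have "d dvd q"
          using irreducible_dvd_free_mult[OF insert.hyps(1) insert.IH insert.hyps(2) d _ q uvw(1,2)]
            False by blast
        then show False using \<open>\<not> d dvd q\<close> by blast
      qed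
    qed
  qed
qed

section \<open>Shifts\<close>

lemma comm_ring_hom_shift_poly: "comm_ring_hom (shift_poly k)"
  unfolding shift_poly_def[abs_def] msubst_conv_mpoly_eval
  by (intro comm_ring_hom_mpoly_eval comm_ring_hom_mconst)

lemma shift_poly_mconst: "shift_poly k (mconst c) = mconst c"
  by (simp add: shift_poly_def msubst_conv_mpoly_eval mpoly_eval_mconst[OF comm_ring_hom_mconst])

lemma shift_poly_mvar: "shift_poly k (mvar i) = mvar i + of_int (k i)"
  by (simp add: shift_poly_def msubst_conv_mpoly_eval mpoly_eval_mvar[OF comm_ring_hom_mconst])

lemmas shift_poly_add = comm_ring_hom.add[OF comm_ring_hom_shift_poly]
lemmas shift_poly_mult = comm_ring_hom.mult[OF comm_ring_hom_shift_poly]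
lemmas shift_poly_0 = comm_ring_hom.zero[OF comm_ring_hom_shift_poly]
lemmas shift_poly_1 = comm_ring_hom.one[OF comm_ring_hom_shift_poly]
lemmas shift_poly_of_int = comm_ring_hom.of_int[OF comm_ring_hom_shift_poly]
lemmas shift_poly_sum = comm_ring_hom.sum[OF comm_ring_hom_shift_poly]
lemmas shift_poly_power = comm_ring_hom.power[OF comm_ring_hom_shift_poly]

lemma shift_poly_shift_poly: "shift_poly k (shift_poly l p) = shift_poly (\<lambda>j. k j + l j) p"
  by (rule hom_mpoly_eqI[OF comm_ring_hom_compose[OF comm_ring_hom_shift_poly comm_ring_hom_shift_poly]
        comm_ring_hom_shift_poly _ _ poly_in_vars_UNIV])
    (simp_all add: shift_poly_mconst shift_poly_mvar shift_poly_add shift_poly_of_int)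

lemma shift_poly_id: "shift_poly (\<lambda>_. 0) p = p"
  by (rule hom_mpoly_eqI[OF comm_ring_hom_shift_poly comm_ring_hom_id _ _ poly_in_vars_UNIV])
    (simp_all add: shift_poly_mconst shift_poly_mvar)

lemma shift_poly_uminus_cancel:
  "shift_poly (\<lambda>j. - k j) (shift_poly k p) = p" "shift_poly k (shift_poly (\<lambda>j. - k j) p) = p"
  by (simp_all add: shift_poly_shift_poly shift_poly_id)

lemma shift_poly_eq_iff: "shift_poly k p = shift_poly k q \<longleftrightarrow> p = q"
  by (metis shift_poly_uminus_cancel(1))

lemma shift_poly_eq_0_iff: "shift_poly k p = 0 \<longleftrightarrow> p = 0"
  by (metis shift_poly_eq_iff shift_poly_0)

lemma poly_in_vars_shift_poly: "poly_in_vars V p \<Longrightarrow> poly_in_vars V (shift_poly k p)"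
  by (induction rule: poly_in_vars_induct)
    (auto simp: shift_poly_mconst shift_poly_mvar shift_poly_add shift_poly_mult
      intro!: poly_in_vars_intros)

lemma shift_poly_dvd_iff: "shift_poly k p dvd shift_poly k q \<longleftrightarrow> p dvd q"
proof
  assume "shift_poly k p dvd shift_poly k q"
  then obtain r where "shift_poly k q = shift_poly k p * r" ..
  then have "shift_poly k q = shift_poly k (p * shift_poly (\<lambda>j. - k j) r)"
    by (simp add: shift_poly_mult shift_poly_uminus_cancel)
  then show "p dvd q" by (simp add: shift_poly_eq_iff)
qed (auto elim!: dvdE simp: shift_poly_mult)

lemma shift_poly_dvd_1_iff: "shift_poly k p dvd 1 \<longleftrightarrow> p dvd 1"
  using shift_poly_dvd_iff[of k p 1] by (simp add: shift_poly_1)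

text \<open>A factorization of the shifted polynomial is carried back to one of \<open>p\<close> by
  the inverse shift, which preserves units.\<close>

lemma irreducible_shift_poly:
  assumes "irreducible p"
  shows "irreducible (shift_poly k p)"
proof (rule irreducibleI)
  fix a b assume ab: "shift_poly k p = a * b"
  have "p = shift_poly (\<lambda>j. - k j) a * shift_poly (\<lambda>j. - k j) b"
    by (simp add: shift_poly_uminus_cancel flip: shift_poly_mult ab)
  then show "a dvd 1 \<or> b dvd 1"
    using assms by (metis irreducible_def shift_poly_dvd_1_iff)
qed (use assms in \<open>auto simp: shift_poly_eq_0_iff shift_poly_dvd_1_iff irreducible_def\<close>)

text \<open>In the expansion by powers of \<open>x\<close>, a shift keeps the coefficients free of
  \<open>x\<close> and turns the \<open>i\<close>-th power of \<open>x\<close> into the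
  \<open>i\<close>-th power of a linear polynomial.\<close>

lemma deg_var_shift_poly_le: "deg_var x (shift_poly k p) \<le> deg_var x p"
proof -
  let ?P = "univ x p"
  have "p = (\<Sum>i\<le>degree ?P. coeff ?P i * mvar x ^ i)"
    using poly_univ[of x p] by (simp add: poly_altdef)
  then have "univ x (shift_poly k p) =
      univ x (shift_poly k (\<Sum>i\<le>degree ?P. coeff ?P i * mvar x ^ i))"
    by (rule arg_cong)
  also have "\<dots> = (\<Sum>i\<le>degree ?P. univ x (shift_poly k (coeff ?P i)) * [:of_int (k x), 1:] ^ i)"
    by (simp add: shift_poly_sum shift_poly_mult shift_poly_power shift_poly_mvar univ_mult
        univ_power univ_add univ_mvar comm_ring_hom.sum[OF comm_ring_hom_univ]
        comm_ring_hom.of_int[OF comm_ring_hom_univ] of_int_poly)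
  also have "\<dots> = (\<Sum>i\<le>degree ?P. [:shift_poly k (coeff ?P i):] * [:of_int (k x), 1:] ^ i)"
    by (intro sum.cong refl arg_cong2[of _ _ _ _ "(*)"] univ_free[of "UNIV - {x}"]
        poly_in_vars_shift_poly poly_in_vars_coeff_univ poly_in_vars_UNIV) auto
  also have "degree \<dots> \<le> degree ?P"
  proof (rule degree_sum_le)
    fix i assume "i \<in> {..degree ?P}"
    have "degree ([:shift_poly k (coeff ?P i):] * [:of_int (k x), 1:] ^ i) \<le>
        degree [:shift_poly k (coeff ?P i):] + degree ([:of_int (k x), 1 :: 'a mpoly:] ^ i)"
      by (rule degree_mult_le)
    also have "degree ([:of_int (k x), 1 :: 'a mpoly:] ^ i) \<le> i"
      using degree_power_le[of "[:of_int (k x), 1 :: 'a mpoly:]" i] by simp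
    finally show "degree ([:shift_poly k (coeff ?P i):] * [:of_int (k x), 1:] ^ i) \<le> degree ?P"
      using \<open>i \<in> _\<close> by simp
  qed simp
  finally show ?thesis by (simp add: degree_univ)
qed

lemma deg_var_shift_poly: "deg_var x (shift_poly k p) = deg_var x p"
  using deg_var_shift_poly_le[of x k p] deg_var_shift_poly_le[of x "\<lambda>j. - k j" "shift_poly k p"]
  by (simp add: shift_poly_uminus_cancel)

text \<open>Restricted to the line \<open>t \<mapsto> x + t k\<close>, the shift by \<open>k\<close> becomes \<open>t \<mapsto> t + 1\<close>,
  which preserves leading coefficients.\<close>

lemma shift_poly_eq_unit_mult:
  fixes p :: "'a::field mpoly"
  assumes "shift_poly k p = c * p" "c dvd 1"
  shows "shift_poly k p = p"
proof (cases "p = 0")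
  case False
  define line :: "'a mpoly \<Rightarrow> 'a mpoly poly" where
    "line = mpoly_eval (\<lambda>c. [:mconst c:]) (\<lambda>i. [:mvar i, of_int (k i):])"
  have hom: "comm_ring_hom line"
    unfolding line_def by (intro comm_ring_hom_mpoly_eval comm_ring_hom_const_mconst)
  have line_mconst: "line (mconst a) = [:mconst a:]" for a
    by (simp add: line_def mpoly_eval_mconst[OF comm_ring_hom_const_mconst])
  have line_mvar: "line (mvar i) = [:mvar i, of_int (k i):]" for i
    by (simp add: line_def mpoly_eval_mvar[OF comm_ring_hom_const_mconst])
  have line_shift: "line (shift_poly k q) = pcompose (line q) [:1, 1:]" for q
    by (rule hom_mpoly_eqI[OF comm_ring_hom_compose[OF hom comm_ring_hom_shift_poly]
          comm_ring_hom_compose[OF comm_ring_hom_pcompose hom] _ _ poly_in_vars_UNIV])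
      (simp_all add: shift_poly_mconst shift_poly_mvar line_mconst line_mvar
        comm_ring_hom.add[OF hom] comm_ring_hom.of_int[OF hom] pcompose_pCons of_int_poly)
  \<comment> \<open>Parameter value 0 recovers the polynomial, so a nonzero polynomial has a nonzero
    restriction.\<close>
  have line_0: "poly (line q) 0 = q" for q
    by (rule hom_mpoly_eqI[OF comm_ring_hom_compose[OF comm_ring_hom_poly hom]
          comm_ring_hom_id _ _ poly_in_vars_UNIV])
      (simp_all add: line_mconst line_mvar)
  have nz: "line p \<noteq> 0"
    using line_0[of p] False by auto
  have "poly_in_vars {} c"
    using poly_in_vars_dvd[OF assms(2) poly_in_vars_1] by simp
  then obtain a where a: "c = mconst a"
    by (rule poly_in_vars_empty)
  have "lead_coeff (line (shift_poly k p)) = lead_coeff (line p)"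
    by (simp add: line_shift lead_coeff_comp)
  moreover have "line (shift_poly k p) = smult c (line p)"
    by (simp add: assms(1) a line_mconst comm_ring_hom.mult[OF hom])
  ultimately have "c * lead_coeff (line p) = lead_coeff (line p)"
    by (metis lead_coeff_smult)
  then have "c = 1" using nz by simp
  then show ?thesis using assms(1) by simp
qed (simp add: shift_poly_0)

section \<open>Shifts of rational functions\<close>

lemma shift_Fract: "shift k (Fract p q) = Fract (shift_poly k p) (shift_poly k q)"
proof -
  \<comment> \<open>Independence of the representative: cross-multiplied equations are preserved by
    \<open>shift_poly\<close>, so the choice in \<open>shift\<close> is determined.\<close>
  have *: "shift k (Fract p q) = Fract (shift_poly k p) (shift_poly k q)" if q: "q \<noteq> 0" for p q
    unfolding shift_def
  proof (rule some_equality)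
    fix g assume "\<exists>p' q'. q' \<noteq> 0 \<and> Fract p q = Fract p' q' \<and>
      g = Fract (shift_poly k p') (shift_poly k q')"
    then obtain p' q' where pq: "q' \<noteq> 0" "Fract p q = Fract p' q'"
      "g = Fract (shift_poly k p') (shift_poly k q')" by blast
    then have "shift_poly k p * shift_poly k q' = shift_poly k p' * shift_poly k q"
      using q by (simp add: eq_fract flip: shift_poly_mult)
    then show "g = Fract (shift_poly k p) (shift_poly k q)"
      using pq q by (simp add: eq_fract shift_poly_eq_0_iff)
  qed (use q in blast)
  show ?thesis
  proof (cases "q = 0")
    case True
    \<comment> \<open>\<open>Fract\<close> with denominator 0 is the zero fraction, which is
      represented by \<open>Fract 0 1\<close>.\<close>
    then show ?thesis using *[of 1 0] by (simp add: shift_poly_0 shift_poly_1 eq_fract)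
  qed (rule *)
qed

lemma comm_ring_hom_shift: "comm_ring_hom (shift k :: 'a::idom mpoly fract \<Rightarrow> _)"
proof
  show "shift k 1 = (1 :: 'a mpoly fract)"
    by (simp add: One_fract_def shift_Fract shift_poly_1)
next
  fix f g :: "'a mpoly fract"
  obtain p q p' q' where fg: "f = Fract p q" "q \<noteq> 0" "g = Fract p' q'" "q' \<noteq> 0"
    by (metis Fract_cases)
  then show "shift k (f + g) = shift k f + shift k g"
    by (simp add: shift_Fract shift_poly_add shift_poly_mult shift_poly_eq_0_iff)
  show "shift k (f * g) = shift k f * shift k g"
    using fg by (simp add: shift_Fract shift_poly_mult)
qed

lemmas shift_add = comm_ring_hom.add[OF comm_ring_hom_shift]
lemmas shift_uminus = comm_ring_hom.uminus[OF comm_ring_hom_shift]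
lemmas shift_0 = comm_ring_hom.zero[OF comm_ring_hom_shift]
lemmas shift_power = comm_ring_hom.power[OF comm_ring_hom_shift]
lemmas shift_sum = comm_ring_hom.sum[OF comm_ring_hom_shift]

lemma shift_divide: "shift k (f / g) = shift k f / shift k g"
  by (cases f; cases g) (simp add: shift_Fract shift_poly_mult)

lemma shift_shift: "shift k (shift l f) = shift (\<lambda>j. k j + l j) f"
  by (cases f) (simp add: shift_Fract shift_poly_shift_poly)

lemma shift_id: "shift (\<lambda>_. 0) f = f"
  by (cases f) (simp add: shift_Fract shift_poly_id)

lemma shift_Fract_1: "shift k (Fract p 1) = Fract (shift_poly k p) 1"
  by (simp add: shift_Fract shift_poly_1)

lemma Fract_1_eq_iff: "Fract p 1 = Fract q 1 \<longleftrightarrow> p = q"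
  by (simp add: eq_fract)

section \<open>Closure properties of the rational functions and of bounded degree in
  \<open>x_1\<close>\<close>

lemma ratfunI: "poly_in_vars {1..m} p \<Longrightarrow> poly_in_vars {1..m} q \<Longrightarrow> q \<noteq> 0 \<Longrightarrow> Fract p q \<in> ratfun m"
  unfolding ratfun_def by blast

lemma ratfunE:
  assumes "f \<in> ratfun m"
  obtains p q where "f = Fract p q" "poly_in_vars {1..m} p" "poly_in_vars {1..m} q" "q \<noteq> 0"
  using assms unfolding ratfun_def by blast

lemma ratfun_0: "0 \<in> ratfun m"
  unfolding Zero_fract_def by (intro ratfunI poly_in_vars_intros) simp

lemma ratfun_uminus: "f \<in> ratfun m \<Longrightarrow> - f \<in> ratfun m"
  by (elim ratfunE) (auto intro!: ratfunI poly_in_vars_intros)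

lemma ratfun_add: "f \<in> ratfun m \<Longrightarrow> g \<in> ratfun m \<Longrightarrow> f + g \<in> ratfun m"
  by (elim ratfunE) (auto intro!: ratfunI poly_in_vars_intros)

lemma ratfun_diff: "f \<in> ratfun m \<Longrightarrow> g \<in> ratfun m \<Longrightarrow> f - g \<in> ratfun m"
  using ratfun_add[OF _ ratfun_uminus, of f m g] by simp

lemma ratfun_shift: "f \<in> ratfun m \<Longrightarrow> shift k f \<in> ratfun m"
  by (elim ratfunE)
    (auto simp: shift_Fract shift_poly_eq_0_iff intro!: ratfunI poly_in_vars_shift_poly)

lemma ratfun_sum: "(\<And>i. i \<in> A \<Longrightarrow> f i \<in> ratfun m) \<Longrightarrow> sum f A \<in> ratfun m"
  by (induction A rule: infinite_finite_induct) (auto intro: ratfun_0 ratfun_add)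

lemma deg_var_add_le: "deg_var x (p + q) \<le> max (deg_var x p) (deg_var x q)"
  by (simp flip: degree_univ add: univ_add degree_add_le_max)

lemma deg_var_uminus: "deg_var x (- p) = deg_var x p"
  by (simp flip: degree_univ add: comm_ring_hom.uminus[OF comm_ring_hom_univ])

lemma deg_var_mult_free_le:
  assumes "poly_in_vars W q" "x \<notin> W"
  shows "deg_var x (p * q) \<le> deg_var x p"
  using degree_mult_le[of "univ x p" "univ x q"] deg_var_free[OF assms]
  by (simp add: degree_univ flip: univ_mult)

lemma in_K_x1_deg_ltI:
  "poly_in_vars {1..m} p \<Longrightarrow> poly_in_vars {2..m} q \<Longrightarrow> q \<noteq> 0 \<Longrightarrow> deg_var 1 p < N \<Longrightarrow>
    in_K_x1_deg_lt m N (Fract p q)"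
  unfolding in_K_x1_deg_lt_def by blast

text \<open>A zero numerator has degree 0, so for positive \<open>N\<close> the exceptional case is
  absorbed into the degree bound.\<close>

lemma in_K_x1_deg_ltE:
  assumes "in_K_x1_deg_lt m N f" "N > 0"
  obtains p q where "f = Fract p q" "poly_in_vars {1..m} p" "poly_in_vars {2..m} q" "q \<noteq> 0"
    "deg_var 1 p < N"
  using assms unfolding in_K_x1_deg_lt_def by (auto simp: deg_var_def)

lemma in_K_x1_deg_lt_ratfun:
  assumes "in_K_x1_deg_lt m N f"
  shows "f \<in> ratfun m"
proof -
  obtain p q where "f = Fract p q" "poly_in_vars {1..m} p" "poly_in_vars {2..m} q" "q \<noteq> 0"
    using assms unfolding in_K_x1_deg_lt_def by blast
  moreover from this have "poly_in_vars {1..m} q"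
    by (elim poly_in_vars_mono) auto
  ultimately show ?thesis by (auto intro: ratfunI)
qed

lemma in_K_x1_deg_lt_0: "in_K_x1_deg_lt m N 0"
  unfolding in_K_x1_deg_lt_def Zero_fract_def
  by (intro exI[of _ 0] exI[of _ 1]) (simp add: poly_in_vars_intros)

lemma in_K_x1_deg_lt_uminus:
  "in_K_x1_deg_lt m N f \<Longrightarrow> N > 0 \<Longrightarrow> in_K_x1_deg_lt m N (- f)"
  by (elim in_K_x1_deg_ltE)
    (auto simp: deg_var_uminus intro!: in_K_x1_deg_ltI poly_in_vars_uminus)

lemma in_K_x1_deg_lt_add:
  assumes "in_K_x1_deg_lt m N f" "in_K_x1_deg_lt m N g" "N > 0"
  shows "in_K_x1_deg_lt m N (f + g)"
proof -
  obtain p q where f: "f = Fract p q" "poly_in_vars {1..m} p" "poly_in_vars {2..m} q" "q \<noteq> 0"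
      "deg_var 1 p < N"
    using assms(1,3) by (rule in_K_x1_deg_ltE)
  obtain p' q' where g: "g = Fract p' q'" "poly_in_vars {1..m} p'" "poly_in_vars {2..m} q'" "q' \<noteq> 0"
      "deg_var 1 p' < N"
    using assms(2,3) by (rule in_K_x1_deg_ltE)
  have up: "poly_in_vars {1..m} r" if "poly_in_vars {2..m} r" for r :: "'a mpoly"
    by (rule poly_in_vars_mono[OF that]) auto
  have "f + g = Fract (p * q' + p' * q) (q * q')"
    using f g by simp
  \<comment> \<open>Cross-multiplication uses only denominators free of \<open>x_1\<close> and so
    does not raise the degree.\<close>
  moreover have "deg_var 1 (p * q') < N" "deg_var 1 (p' * q) < N"
    using f g deg_var_mult_free_le[of "{2..m}" q' 1 p] deg_var_mult_free_le[of "{2..m}" q 1 p']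
    by auto
  then have "deg_var 1 (p * q' + p' * q) < N"
    using deg_var_add_le[of 1 "p * q'" "p' * q"] by simp
  ultimately show ?thesis
    using f g by (auto intro!: in_K_x1_deg_ltI poly_in_vars_add poly_in_vars_mult intro: up)
qed

lemma in_K_x1_deg_lt_shift:
  assumes "in_K_x1_deg_lt m N f" "N > 0"
  shows "in_K_x1_deg_lt m N (shift k f)"
  using assms
  by (elim in_K_x1_deg_ltE) (auto simp: shift_Fract deg_var_shift_poly shift_poly_eq_0_iff
      intro!: in_K_x1_deg_ltI poly_in_vars_shift_poly)

section \<open>Pole expansions\<close>

declare One_nat_def [simp del]

text \<open>Factors of a nonzero polynomial in the first \<open>m\<close> variables involve only
  those variables, so the infinitely many others add no factorizations.\<close>

lemma irreducible_in_iff: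
  fixes d :: "'a::idom mpoly"
  shows "irreducible_in m d \<longleftrightarrow> poly_in_vars {1..m} d \<and> irreducible d"
proof
  assume d: "irreducible_in m d"
  show "poly_in_vars {1..m} d \<and> irreducible d"
  proof (intro conjI irreducibleI)
    fix a b assume ab: "d = a * b"
    with d have "poly_in_vars {1..m} a" "poly_in_vars {1..m} b"
      using poly_in_vars_factor[of "{1..m}" a b] unfolding irreducible_in_def by blast+
    with d ab show "a dvd 1 \<or> b dvd 1" unfolding irreducible_in_def by blast
  qed (use d in \<open>auto simp: irreducible_in_def\<close>)
qed (auto simp: irreducible_in_def irreducible_def)

text \<open>For prime \<open>e\<close> this is the localization of the polynomial ring at the ideal
  generated by \<open>e\<close>.\<close>

definition regular_at :: "nat \<Rightarrow> 'a::idom mpoly \<Rightarrow> 'a mpoly fract set" where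
  "regular_at m e =
     {Fract p q | p q. poly_in_vars {1..m} p \<and> poly_in_vars {1..m} q \<and> \<not> e dvd q}"

text \<open>The pole part of the \<open>e\<close>-adic expansion. Requiring zeros beyond
  \<open>M\<close> makes expansions of different lengths comparable; \<open>\<alpha> 0\<close> does
  not enter the sum, so uniqueness can hold only from index 1.\<close>

definition pole_expansion :: "nat \<Rightarrow> 'a::idom mpoly \<Rightarrow> 'a mpoly fract \<Rightarrow>
    (nat \<Rightarrow> 'a mpoly fract) \<Rightarrow> nat \<Rightarrow> 'a mpoly fract \<Rightarrow> bool" where
  "pole_expansion m e f \<alpha> M u \<longleftrightarrow> u \<in> regular_at m e \<and>
     (\<forall>k. in_K_x1_deg_lt m (deg_var 1 e) (\<alpha> k)) \<and> (\<forall>k>M. \<alpha> k = 0) \<and>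
     f = u + (\<Sum>k=1..M. \<alpha> k / Fract e 1 ^ k)"

text \<open>The description is meaningful for \<open>j \<ge> 1\<close> and \<open>f\<close> in
  \<open>ratfun m\<close> once existence and uniqueness of expansions are known.\<close>

definition pole_coeff :: "nat \<Rightarrow> 'a::idom mpoly \<Rightarrow> nat \<Rightarrow> 'a mpoly fract \<Rightarrow> 'a mpoly fract" where
  "pole_coeff m e j f = (THE c. \<exists>\<alpha> M u. pole_expansion m e f \<alpha> M u \<and> c = \<alpha> j)"

lemma regular_atI:
  "poly_in_vars {1..m} p \<Longrightarrow> poly_in_vars {1..m} q \<Longrightarrow> \<not> e dvd q \<Longrightarrow> Fract p q \<in> regular_at m e"
  unfolding regular_at_def by blast

lemma regular_atE:
  assumes "f \<in> regular_at m e"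
  obtains p q where "f = Fract p q" "poly_in_vars {1..m} p" "poly_in_vars {1..m} q" "\<not> e dvd q"
    "q \<noteq> 0"
  using assms unfolding regular_at_def by fastforce

lemma regular_at_shift:
  "f \<in> regular_at m e \<Longrightarrow> shift k f \<in> regular_at m (shift_poly k e)"
  by (elim regular_atE)
    (auto simp: shift_Fract shift_poly_dvd_iff intro!: regular_atI poly_in_vars_shift_poly)

text \<open>A shift is a field automorphism that preserves degrees in \<open>x_1\<close> and carries
  regularity at \<open>e\<close> to regularity at the shifted \<open>e\<close>, so expansions are
  transported term by term.\<close>

lemma pole_expansion_shift:
  assumes "pole_expansion m e f \<alpha> M u" "deg_var 1 e > 0"
  shows "pole_expansion m (shift_poly k e) (shift k f) (\<lambda>i. shift k (\<alpha> i)) M (shift k u)"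
  using assms unfolding pole_expansion_def
  by (auto simp: regular_at_shift deg_var_shift_poly shift_0 shift_add shift_sum shift_divide
      shift_power shift_Fract_1 in_K_x1_deg_lt_shift)

section \<open>Pole expansions at one fixed irreducible polynomial\<close>

locale mpoly_irreducible =
  fixes m :: nat and e :: "'a::field mpoly"
  assumes m: "1 \<le> m" and irr: "irreducible e" and vars: "poly_in_vars {1..m} e"
    and deg: "deg_var 1 e > 0"
begin

abbreviation "K \<equiv> in_K_x1_deg_lt m (deg_var 1 e)"

abbreviation "pole \<equiv> Fract e 1"

lemma e_nz: "e \<noteq> 0"
  using irr by (auto simp: irreducible_def)

lemma pole_nz: "pole \<noteq> 0"
  using e_nz by (simp add: eq_fract Zero_fract_def)

lemma vars_insert: "insert 1 {2..m} = {1..m}"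
  using m by auto

lemma weaken: "poly_in_vars {2..m} p \<Longrightarrow> poly_in_vars {1..m} p"
  by (erule poly_in_vars_mono) auto

lemma prime_dvd:
  assumes "poly_in_vars {1..m} p" "poly_in_vars {1..m} q" "e dvd p * q"
  shows "e dvd p \<or> e dvd q"
  using irreducibles_prime_in_finite[of "{1..m}", where 'a = 'a] assms irr vars
  unfolding irreducibles_prime_in_def by blast

lemma not_dvd_1: "\<not> e dvd 1"
  using irr by (simp add: irreducible_def)

lemma not_dvd_free:
  assumes "poly_in_vars {2..m} q" "q \<noteq> 0"
  shows "\<not> e dvd q"
proof
  assume "e dvd q"
  then obtain r where r: "q = e * r" ..
  then have "deg_var 1 q = deg_var 1 e + deg_var 1 r"
    using assms e_nz by (simp add: deg_var_mult)
  then show False using deg deg_var_free[OF assms(1), of 1] by simp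
qed

lemma regular_poly: "poly_in_vars {1..m} p \<Longrightarrow> Fract p 1 \<in> regular_at m e"
  by (intro regular_atI poly_in_vars_1 not_dvd_1)

lemma regular_0: "0 \<in> regular_at m e"
  unfolding Zero_fract_def by (intro regular_poly poly_in_vars_0)

lemma regular_uminus: "f \<in> regular_at m e \<Longrightarrow> - f \<in> regular_at m e"
  by (elim regular_atE) (auto intro!: regular_atI poly_in_vars_uminus)

lemma regular_add: "f \<in> regular_at m e \<Longrightarrow> g \<in> regular_at m e \<Longrightarrow> f + g \<in> regular_at m e"
  by (elim regular_atE)
    (auto dest: prime_dvd
      intro!: regular_atI poly_in_vars_add poly_in_vars_mult)

lemma regular_mult: "f \<in> regular_at m e \<Longrightarrow> g \<in> regular_at m e \<Longrightarrow> f * g \<in> regular_at m e"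
  by (elim regular_atE) (auto dest: prime_dvd
      intro!: regular_atI poly_in_vars_mult)

lemma regular_power: "f \<in> regular_at m e \<Longrightarrow> f ^ n \<in> regular_at m e"
  using regular_poly[OF poly_in_vars_1]
  by (induction n) (auto intro: regular_mult simp: One_fract_def)

lemma regular_sum: "(\<And>i. i \<in> A \<Longrightarrow> f i \<in> regular_at m e) \<Longrightarrow> sum f A \<in> regular_at m e"
  by (induction A rule: infinite_finite_induct) (auto intro: regular_0 regular_add)

lemma regular_K: "K f \<Longrightarrow> f \<in> regular_at m e"
  by (elim in_K_x1_deg_ltE[OF _ deg]) (auto intro!: regular_atI intro: weaken dest: not_dvd_free)

text \<open>Uniqueness of digits: primality makes \<open>e\<close> divide the numerator of
  \<open>f\<close>, whose degree in \<open>x_1\<close> is too small unless it is zero.\<close>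

lemma K_multiple_eq_0:
  assumes "K f" "v \<in> regular_at m e" "f = pole * v"
  shows "f = 0"
proof -
  obtain p q where f: "f = Fract p q" "poly_in_vars {1..m} p" "poly_in_vars {2..m} q" "q \<noteq> 0"
      "deg_var 1 p < deg_var 1 e"
    using assms(1) deg by (rule in_K_x1_deg_ltE)
  obtain p' q' where v: "v = Fract p' q'" "poly_in_vars {1..m} p'" "poly_in_vars {1..m} q'"
      "\<not> e dvd q'" "q' \<noteq> 0"
    using assms(2) by (rule regular_atE)
  have "p * q' = e * (p' * q)"
    using assms(3) f(4) v(5) by (simp add: f(1) v(1) eq_fract mult_ac)
  then have "e dvd p * q'" by simp
  then have "e dvd p"
    using prime_dvd f(2) v(3,4) by blast
  then obtain r where r: "p = e * r" ..
  have "p = 0"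
  proof (rule ccontr)
    assume "p \<noteq> 0"
    then have "deg_var 1 p = deg_var 1 e + deg_var 1 r"
      using r by (simp add: deg_var_mult)
    then show False using f(5) by simp
  qed
  then show ?thesis by (simp add: f(1) Zero_fract_def eq_fract)
qed

text \<open>Existence of digits: Bezout inverts the denominator modulo \<open>e\<close> up to a
  factor \<open>w\<close> free of \<open>x_1\<close>, and pseudo-division reduces the resulting
  numerator below the degree of \<open>e\<close>.\<close>

lemma regular_decomp:
  assumes "f \<in> regular_at m e"
  shows "\<exists>\<alpha> v. K \<alpha> \<and> v \<in> regular_at m e \<and> f = \<alpha> + pole * v"
proof -
  obtain p q where f: "f = Fract p q" "poly_in_vars {1..m} p" "poly_in_vars {1..m} q"
      "\<not> e dvd q" "q \<noteq> 0"
    using assms by (rule regular_atE)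
  have prime: "irreducibles_prime_in {2..m} TYPE('a)"
    by (intro irreducibles_prime_in_finite) simp
  obtain u v w where uvw: "poly_in_vars {1..m} u" "poly_in_vars {1..m} v" "poly_in_vars {2..m} w"
      "w \<noteq> 0" "u * q + v * e = w"
    using irreducible_bezout[OF _ prime _ irr _ deg _ f(4)] vars f(3) vars_insert by auto
  have "poly_in_vars {1..m} (p * u)"
    using f uvw by (intro poly_in_vars_mult)
  then obtain c h r where chr: "poly_in_vars {2..m} c" "c \<noteq> 0" "poly_in_vars {1..m} h"
      "poly_in_vars {1..m} r" "c * (p * u) = e * h + r" "r = 0 \<or> deg_var 1 r < deg_var 1 e"
    using mpoly_pseudo_division[of 1 "{2..m}" e "p * u"] e_nz vars vars_insert by auto
  have "w * c \<noteq> 0" "poly_in_vars {2..m} (w * c)"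
    using uvw chr by (auto intro: poly_in_vars_mult)
  note wc = this weaken[OF this(2)] not_dvd_free[OF this(2,1)]
  \<comment> \<open>Both witnesses are read off from the identity
    \<open>p * (w * c) = r * q + e * (h * q + c * p * v)\<close> after division by
    \<open>q * (w * c)\<close>.\<close>
  define \<alpha> where "\<alpha> = Fract r (w * c)"
  define v' where "v' = Fract (h * q + c * p * v) (q * (w * c))"
  have "K \<alpha>"
    unfolding \<alpha>_def in_K_x1_deg_lt_def using chr wc by blast
  moreover have "v' \<in> regular_at m e"
    unfolding v'_def using f uvw chr wc vars prime_dvd[of q "w * c"]
    by (auto intro!: regular_atI poly_in_vars_add poly_in_vars_mult intro: weaken)
  moreover have "f = \<alpha> + pole * v'"
  proof -
    have "p * (w * c) = c * (p * u) * q + c * p * v * e"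
      by (simp flip: uvw(5) add: algebra_simps)
    also have "\<dots> = r * q + e * (h * q + c * p * v)"
      by (simp add: chr(5) algebra_simps)
    finally have eq: "p * (w * c) = r * q + e * (h * q + c * p * v)" .
    have "\<alpha> = Fract (r * q) (q * (w * c))"
      using f(5) wc(1) by (simp add: \<alpha>_def eq_fract mult_ac)
    then have "\<alpha> + pole * v' = Fract (p * (w * c)) (q * (w * c))"
      unfolding eq using f(5) wc(1) by (simp add: v'_def eq_fract algebra_simps)
    then show ?thesis
      using f(5) wc(1) by (simp add: f(1) eq_fract mult_ac)
  qed
  ultimately show ?thesis by blast
qed

text \<open>Clearing the highest power of \<open>e\<close> exhibits the top coefficient as
  \<open>e\<close> times a regular element, hence as zero; the others follow by induction on
  \<open>M\<close>.\<close>

lemma pole_expansion_0: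
  assumes "pole_expansion m e 0 \<alpha> M u"
  shows "\<forall>k\<ge>1. \<alpha> k = 0"
  using assms
proof (induction M)
  case 0
  then show ?case by (simp add: pole_expansion_def)
next
  case (Suc M)
  then have u: "u \<in> regular_at m e" and \<alpha>: "\<And>k. K (\<alpha> k)" and gt: "\<And>k. k > Suc M \<Longrightarrow> \<alpha> k = 0"
    and sum: "0 = u + (\<Sum>k=1..Suc M. \<alpha> k / pole ^ k)"
    unfolding pole_expansion_def by blast+
  have "(\<Sum>k=1..Suc M. \<alpha> k / pole ^ k) =
      (\<Sum>k=1..M. \<alpha> k / pole ^ k) + \<alpha> (Suc M) / pole ^ Suc M"
    by (simp only: sum.cl_ivl_Suc) simp
  with sum have sum0: "0 = u + (\<Sum>k=1..M. \<alpha> k / pole ^ k) + \<alpha> (Suc M) / pole ^ Suc M"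
    by (simp only: add.assoc)
  let ?v = "- (pole ^ M * u + (\<Sum>k=1..M. \<alpha> k * pole ^ (M - k)))"
  have "pole ^ Suc M * (u + (\<Sum>k=1..M. \<alpha> k / pole ^ k)) =
      pole * (pole ^ M * u + (\<Sum>k=1..M. pole ^ M * (\<alpha> k / pole ^ k)))"
    by (simp add: algebra_simps sum_distrib_left)
  also have "(\<Sum>k=1..M. pole ^ M * (\<alpha> k / pole ^ k)) = (\<Sum>k=1..M. \<alpha> k * pole ^ (M - k))"
    using pole_nz by (intro sum.cong) (auto simp: power_diff)
  finally have "pole ^ Suc M * (u + (\<Sum>k=1..M. \<alpha> k / pole ^ k)) = - (pole * ?v)"
    by (simp only: mult_minus_right minus_minus)
  moreover have "pole ^ Suc M * (u + (\<Sum>k=1..M. \<alpha> k / pole ^ k)) = - \<alpha> (Suc M)"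
  proof -
    have "u + (\<Sum>k=1..M. \<alpha> k / pole ^ k) = - (\<alpha> (Suc M) / pole ^ Suc M)"
      by (simp only: eq_neg_iff_add_eq_0 sum0[symmetric])
    then show ?thesis using pole_nz by simp
  qed
  ultimately have "- \<alpha> (Suc M) = - (pole * ?v)"
    by (rule trans[OF sym, rotated])
  then have "\<alpha> (Suc M) = pole * ?v"
    by (simp only: neg_equal_iff_equal)
  moreover have "?v \<in> regular_at m e"
    by (intro regular_uminus regular_add regular_mult regular_power regular_sum u
        regular_K[OF \<alpha>] regular_poly[OF vars])
  ultimately have 0: "\<alpha> (Suc M) = 0"
    using K_multiple_eq_0[OF \<alpha>] by blast
  have "pole_expansion m e 0 \<alpha> M u"
    unfolding pole_expansion_def
  proof (intro conjI allI impI u \<alpha>)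
    show "\<alpha> k = 0" if "M < k" for k
      using that gt 0 by (cases "k = Suc M") auto
    show "0 = u + (\<Sum>k=1..M. \<alpha> k / pole ^ k)"
      using sum0 unfolding 0 by (simp only: div_0 add_0_right)
  qed
  then show ?case by (rule Suc.IH)
qed

lemma pole_expansion_pad:
  assumes "pole_expansion m e f \<alpha> M u" "M \<le> M'"
  shows "pole_expansion m e f \<alpha> M' u"
proof -
  have "(\<Sum>k=1..M'. \<alpha> k / pole ^ k) = (\<Sum>k=1..M. \<alpha> k / pole ^ k)"
    using assms by (intro sum.mono_neutral_right) (auto simp: pole_expansion_def)
  then show ?thesis
    using assms by (auto simp: pole_expansion_def)
qed

lemma pole_expansion_add:
  assumes "pole_expansion m e f \<alpha> M u" "pole_expansion m e g \<beta> M' v"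
  shows "pole_expansion m e (f + g) (\<lambda>k. \<alpha> k + \<beta> k) (max M M') (u + v)"
  using pole_expansion_pad[OF assms(1), of "max M M'"] pole_expansion_pad[OF assms(2), of "max M M'"]
  by (auto simp: pole_expansion_def add_divide_distrib sum.distrib
      intro: regular_add in_K_x1_deg_lt_add deg)

lemma pole_expansion_uminus:
  assumes "pole_expansion m e f \<alpha> M u"
  shows "pole_expansion m e (- f) (\<lambda>k. - \<alpha> k) M (- u)"
  using assms
  by (auto simp: pole_expansion_def sum_negf intro: regular_uminus in_K_x1_deg_lt_uminus deg)

text \<open>The difference of two expansions of \<open>f\<close> is an expansion of 0.\<close>

lemma pole_expansion_unique:
  assumes "pole_expansion m e f \<alpha> M u" "pole_expansion m e f \<beta> M' v" "k \<ge> 1"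
  shows "\<alpha> k = \<beta> k"
  using pole_expansion_0 pole_expansion_add[OF assms(1) pole_expansion_uminus[OF assms(2)]] assms(3)
  by fastforce

lemma pole_coeff_eqI:
  assumes "pole_expansion m e f \<alpha> M u" "j \<ge> 1"
  shows "pole_coeff m e j f = \<alpha> j"
  unfolding pole_coeff_def
  using assms pole_expansion_unique by (intro the_equality) blast+

text \<open>Splitting \<open>v\<close> into a digit \<open>\<beta>\<close> plus
  \<open>pole * v'\<close> gives the coefficient of the highest power and leaves a quotient with one
  power less.\<close>

lemma exists_pole_expansion_quotient:
  "v \<in> regular_at m e \<Longrightarrow> \<exists>\<alpha> u. pole_expansion m e (v / pole ^ M) \<alpha> M u"
proof (induction M arbitrary: v)
  case 0
  then show ?case
    by (intro exI[of _ "\<lambda>_. 0"] exI[of _ v]) (simp add: pole_expansion_def in_K_x1_deg_lt_0)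
next
  case (Suc M)
  obtain \<beta> v' where \<beta>: "K \<beta>" "v' \<in> regular_at m e" "v = \<beta> + pole * v'"
    using regular_decomp[OF Suc.prems] by blast
  obtain \<alpha> u where \<alpha>: "pole_expansion m e (v' / pole ^ M) \<alpha> M u"
    using Suc.IH[OF \<beta>(2)] by blast
  have "v / pole ^ Suc M = v' / pole ^ M + \<beta> / pole ^ Suc M"
    using pole_nz by (simp add: \<beta>(3) add_divide_distrib)
  moreover have "(\<Sum>k=1..M. (\<alpha>(Suc M := \<beta>)) k / pole ^ k) = (\<Sum>k=1..M. \<alpha> k / pole ^ k)"
    by (intro sum.cong) auto
  ultimately have "pole_expansion m e (v / pole ^ Suc M) (\<alpha>(Suc M := \<beta>)) (Suc M) u"
    using \<alpha> \<beta>(1) by (auto simp: pole_expansion_def add.assoc)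
  then show ?case by blast
qed

text \<open>Each division by \<open>e\<close> lowers the degree in \<open>x_1\<close>, because
  \<open>e\<close> has positive degree there.\<close>

lemma extract_power:
  assumes "poly_in_vars {1..m} q" "q \<noteq> 0"
  shows "\<exists>M r. q = r * e ^ M \<and> poly_in_vars {1..m} r \<and> \<not> e dvd r"
  using assms
proof (induction "deg_var 1 q" arbitrary: q rule: less_induct)
  case less
  show ?case
  proof (cases "e dvd q")
    case False
    then show ?thesis using less.prems by (intro exI[of _ 0] exI[of _ q]) simp
  next
    case True
    then obtain q' where q': "q = e * q'" ..
    then have "q' \<noteq> 0" using less.prems by auto
    moreover have "poly_in_vars {1..m} q'"
      using poly_in_vars_factor(2)[of "{1..m}" e q'] less.prems by (simp flip: q')
    moreover have "deg_var 1 q' < deg_var 1 q"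
      using deg e_nz calculation by (simp add: q' deg_var_mult)
    ultimately obtain M r where "q' = r * e ^ M" "poly_in_vars {1..m} r" "\<not> e dvd r"
      using less.hyps by blast
    then show ?thesis
      by (intro exI[of _ "Suc M"] exI[of _ r]) (simp add: q' mult_ac)
  qed
qed

lemma Fract_power: "Fract p 1 ^ M = Fract (p ^ M) 1"
  by (induction M) (simp_all add: One_fract_def)

lemma exists_pole_expansion:
  assumes "f \<in> ratfun m"
  shows "\<exists>\<alpha> M u. pole_expansion m e f \<alpha> M u"
proof -
  obtain p q where f: "f = Fract p q" "poly_in_vars {1..m} p" "poly_in_vars {1..m} q" "q \<noteq> 0"
    using assms by (rule ratfunE)
  obtain M r where r: "q = r * e ^ M" "poly_in_vars {1..m} r" "\<not> e dvd r"
    using extract_power[OF f(3,4)] by blast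
  have "f = Fract p r / pole ^ M"
    by (simp add: f(1) r(1) Fract_power)
  moreover have "Fract p r \<in> regular_at m e"
    using f r by (intro regular_atI)
  ultimately show ?thesis
    using exists_pole_expansion_quotient by blast
qed

lemma pole_coeff_in_K:
  assumes "f \<in> ratfun m" "j \<ge> 1"
  shows "K (pole_coeff m e j f)"
  using exists_pole_expansion[OF assms(1)] pole_coeff_eqI[OF _ assms(2)]
  by (metis pole_expansion_def)

lemma pole_coeff_add:
  assumes "f \<in> ratfun m" "g \<in> ratfun m" "j \<ge> 1"
  shows "pole_coeff m e j (f + g) = pole_coeff m e j f + pole_coeff m e j g"
proof -
  obtain \<alpha> M u \<beta> M' v where *: "pole_expansion m e f \<alpha> M u" "pole_expansion m e g \<beta> M' v"
    using exists_pole_expansion assms by blast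
  show ?thesis
    using pole_coeff_eqI[OF *(1) assms(3)] pole_coeff_eqI[OF *(2) assms(3)]
      pole_coeff_eqI[OF pole_expansion_add[OF *] assms(3)] by simp
qed

lemma pole_coeff_regular:
  assumes "f \<in> regular_at m e" "j \<ge> 1"
  shows "pole_coeff m e j f = 0"
  using assms by (intro pole_coeff_eqI[of _ "\<lambda>_. 0" 0 f])
    (simp_all add: pole_expansion_def in_K_x1_deg_lt_0)

lemma pole_coeff_power:
  assumes "K a" "j \<ge> 1"
  shows "pole_coeff m e j (a / pole ^ j) = a"
proof -
  have "(\<Sum>k=1..j. ((\<lambda>_. 0)(j := a)) k / pole ^ k) = (\<Sum>k=1..j. if k = j then a / pole ^ k else 0)"
    by (intro sum.cong) auto
  also have "\<dots> = a / pole ^ j"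
    using assms(2) by (simp add: sum.delta)
  finally have "pole_expansion m e (a / pole ^ j) ((\<lambda>_. 0)(j := a)) j 0"
    using assms by (auto simp: pole_expansion_def in_K_x1_deg_lt_0 regular_0)
  from pole_coeff_eqI[OF this assms(2)] show ?thesis by simp
qed

lemma mpoly_irreducible_shift: "mpoly_irreducible m (shift_poly k e)"
  using m irr vars deg
  by unfold_locales
    (simp_all add: irreducible_shift_poly poly_in_vars_shift_poly deg_var_shift_poly)

lemma pole_coeff_shift:
  assumes "f \<in> ratfun m" "j \<ge> 1"
  shows "pole_coeff m (shift_poly k e) j (shift k f) = shift k (pole_coeff m e j f)"
proof -
  interpret s: mpoly_irreducible m "shift_poly k e"
    by (rule mpoly_irreducible_shift)
  obtain \<alpha> M u where *: "pole_expansion m e f \<alpha> M u"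
    using exists_pole_expansion assms by blast
  show ?thesis
    using pole_coeff_eqI[OF * assms(2)] s.pole_coeff_eqI[OF pole_expansion_shift[OF * deg] assms(2)]
    by simp
qed

end

section \<open>Orbits under the shift group\<close>

lemma Delta_add: "Delta k (f + g) = Delta k f + Delta k g"
  by (simp add: Delta_def shift_add)

lemma Delta_uminus: "Delta k (- f) = - Delta k f"
  by (simp add: Delta_def shift_uminus)

lemma Delta_0: "Delta k 0 = 0"
  by (simp add: Delta_def shift_0)

text \<open>The exponent vectors \<open>k\<close> whose \<open>Delta k\<close> maps \<open>A\<close>
  into \<open>M\<close> form a group, because \<open>A\<close> is stable under shifts. This serves
  both for unit vectors and for a basis of the isotropy group.\<close>

lemma Delta_int_combination:
  assumes A: "\<And>k f. f \<in> A \<Longrightarrow> shift k f \<in> A"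
    and M: "0 \<in> M" "\<And>x y. x \<in> M \<Longrightarrow> y \<in> M \<Longrightarrow> x + y \<in> M" "\<And>x. x \<in> M \<Longrightarrow> - x \<in> M"
    and gen: "\<And>i f. i \<in> I \<Longrightarrow> f \<in> A \<Longrightarrow> Delta (v i) f \<in> M"
    and f: "f \<in> A"
  shows "Delta (\<lambda>j. \<Sum>i\<in>I. c i * v i j) f \<in> M"
proof -
  define S where "S = {k. \<forall>f\<in>A. Delta k f \<in> M}"
  have zero: "(\<lambda>_. 0) \<in> S"
    by (simp add: S_def Delta_def shift_id M(1))
  have add: "(\<lambda>j. k j + l j) \<in> S" if "k \<in> S" "l \<in> S" for k l
  proof -
    have "Delta (\<lambda>j. k j + l j) f = Delta k (shift l f) + Delta l f" for f :: "'a mpoly fract"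
      by (simp add: Delta_def shift_shift)
    then show ?thesis using that A M(2) by (simp add: S_def)
  qed
  have neg: "(\<lambda>j. - k j) \<in> S" if "k \<in> S" for k
  proof -
    have "Delta (\<lambda>j. - k j) f = - Delta k (shift (\<lambda>j. - k j) f)" for f :: "'a mpoly fract"
      by (simp add: Delta_def shift_shift shift_id)
    then show ?thesis using that A M(3) by (simp add: S_def)
  qed
  have nat: "(\<lambda>j. int n * k j) \<in> S" if "k \<in> S" for k n
  proof (induction n)
    case (Suc n)
    then show ?case using add[OF that Suc] by (simp add: algebra_simps)
  qed (simp add: zero)
  have int: "(\<lambda>j. z * k j) \<in> S" if "k \<in> S" for k and z :: int
    using nat[OF that, of "nat z"] neg[OF nat[OF that, of "nat (- z)"]] by (cases "z \<ge> 0") simp_all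
  have "(\<lambda>j. \<Sum>i\<in>J. c i * v i j) \<in> S" if "J \<subseteq> I" for J
    using that
  proof (induction J rule: infinite_finite_induct)
    case (insert i J)
    then have "v i \<in> S" using gen by (auto simp: S_def)
    from add[OF int[OF this] insert.IH] insert.hyps insert.prems show ?case by simp
  qed (simp_all add: zero)
  then show ?thesis using f by (auto simp: S_def)
qed

lemma shift_vecs_uminus: "k \<in> shift_vecs n \<Longrightarrow> (\<lambda>j. - k j) \<in> shift_vecs n"
  by (simp add: shift_vecs_def)

lemma shift_vecs_add: "k \<in> shift_vecs n \<Longrightarrow> l \<in> shift_vecs n \<Longrightarrow> (\<lambda>j. k j + l j) \<in> shift_vecs n"
  by (simp add: shift_vecs_def)

lemma shift_vecs_0: "(\<lambda>_. 0) \<in> shift_vecs n"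
  by (simp add: shift_vecs_def)

lemma unitvec_in_shift_vecs: "i \<in> {1..n} \<Longrightarrow> unitvec i \<in> shift_vecs n"
  by (auto simp: shift_vecs_def unitvec_def)

lemma isotropy_iff: "k \<in> isotropy n d \<longleftrightarrow> k \<in> shift_vecs n \<and> shift_poly k d = d"
  by (simp add: isotropy_def shift_Fract_1 Fract_1_eq_iff)

section \<open>Closure properties of summability\<close>

lemma summable_0: "summable m n 0"
  unfolding summable_def by (intro exI[of _ "\<lambda>_. 0"]) (simp add: ratfun_0 shift_0)

lemma summable_add:
  assumes "summable m n f" "summable m n g"
  shows "summable m n (f + g)"
proof -
  obtain u v where "\<forall>i\<in>{1..n}. u i \<in> ratfun m" "f = (\<Sum>i=1..n. shift (unitvec i) (u i) - u i)"
    "\<forall>i\<in>{1..n}. v i \<in> ratfun m" "g = (\<Sum>i=1..n. shift (unitvec i) (v i) - v i)"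
    using assms unfolding summable_def by blast
  then show ?thesis
    unfolding summable_def
    by (intro exI[of _ "\<lambda>i. u i + v i"])
      (simp add: ratfun_add shift_add add_diff_add sum.distrib)
qed

lemma summable_uminus:
  assumes "summable m n f"
  shows "summable m n (- f)"
proof -
  obtain u where "\<forall>i\<in>{1..n}. u i \<in> ratfun m" "f = (\<Sum>i=1..n. shift (unitvec i) (u i) - u i)"
    using assms unfolding summable_def by blast
  then show ?thesis
    unfolding summable_def
    by (intro exI[of _ "\<lambda>i. - u i"])
      (simp add: ratfun_uminus shift_uminus flip: sum_negf)
qed

lemma summable_sum: "(\<And>i. i \<in> A \<Longrightarrow> summable m n (f i)) \<Longrightarrow> summable m n (sum f A)"
  by (induction A rule: infinite_finite_induct) (auto intro: summable_0 summable_add)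

lemma summable_Delta_unitvec:
  assumes "i \<in> {1..n}" "g \<in> ratfun m"
  shows "summable m n (Delta (unitvec i) g)"
proof -
  have "(\<Sum>l=1..n. shift (unitvec l) (if l = i then g else 0) - (if l = i then g else 0)) =
      (\<Sum>l=1..n. if l = i then Delta (unitvec l) g else 0)"
    by (intro sum.cong) (auto simp: Delta_def shift_0)
  then show ?thesis
    using assms unfolding summable_def
    by (intro exI[of _ "\<lambda>l. if l = i then g else 0"]) (simp add: ratfun_0 sum.delta)
qed

lemma summable_Delta:
  assumes "k \<in> shift_vecs n" "g \<in> ratfun m"
  shows "summable m n (Delta k g)"
proof -
  have "Delta (\<lambda>j. \<Sum>i\<in>{1..n}. k i * unitvec i j) g \<in> Collect (summable m n)"
    by (rule Delta_int_combination[where A = "ratfun m"])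
      (use assms(2) in \<open>auto intro: ratfun_shift summable_0 summable_add summable_uminus
        summable_Delta_unitvec\<close>)
  moreover have "(\<lambda>j. \<Sum>i\<in>{1..n}. k i * unitvec i j) = k"
  proof
    fix j
    have "(\<Sum>i\<in>{1..n}. k i * unitvec i j) = (\<Sum>i\<in>{1..n}. if i = j then k i else 0)"
      by (intro sum.cong) (auto simp: unitvec_def)
    then show "(\<Sum>i\<in>{1..n}. k i * unitvec i j) = k j"
      using assms(1) by (simp add: sum.delta shift_vecs_def)
  qed
  ultimately show ?thesis by simp
qed

section \<open>The trace over the orbit of \<open>d\<close>\<close>

locale shift_orbit = mpoly_irreducible m d for m :: nat and d :: "'a::field mpoly" +
  fixes n j :: nat
  assumes j: "j \<ge> 1"
begin

definition orbit :: "'a mpoly set" where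
  "orbit = (\<lambda>k. shift_poly k d) ` shift_vecs n"

text \<open>The choice is arbitrary: \<open>orbit_rep d\<close> fixes \<open>d\<close> but need not
  be the zero vector.\<close>

definition orbit_rep :: "'a mpoly \<Rightarrow> nat \<Rightarrow> int" where
  "orbit_rep e = (SOME k. k \<in> shift_vecs n \<and> shift_poly k d = e)"

definition support :: "'a mpoly fract \<Rightarrow> 'a mpoly set" where
  "support f = {e \<in> orbit. pole_coeff m e j f \<noteq> 0}"

text \<open>This is the map \<open>\<Phi>\<close>. The orbit may be infinite, so the sum runs over
  the poles that contribute.\<close>

definition orbit_trace :: "'a mpoly fract \<Rightarrow> 'a mpoly fract" where
  "orbit_trace f = (\<Sum>e\<in>support f. shift (\<lambda>i. - orbit_rep e i) (pole_coeff m e j f))"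

lemma orbit_rep:
  assumes "e \<in> orbit"
  shows "orbit_rep e \<in> shift_vecs n" "shift_poly (orbit_rep e) d = e"
  using assms someI_ex[of "\<lambda>k. k \<in> shift_vecs n \<and> shift_poly k d = e"]
  unfolding orbit_rep_def orbit_def by blast+

lemma orbit_irreducible: "e \<in> orbit \<Longrightarrow> mpoly_irreducible m e"
  using mpoly_irreducible_shift by (auto simp: orbit_def)

lemma d_in_orbit: "d \<in> orbit"
  unfolding orbit_def using shift_vecs_0 shift_poly_id by (metis imageI)

lemma orbit_shift: "e \<in> orbit \<Longrightarrow> k \<in> shift_vecs n \<Longrightarrow> shift_poly k e \<in> orbit"
  unfolding orbit_def by (auto simp: shift_poly_shift_poly intro!: imageI shift_vecs_add)

text \<open>Irreducibility makes the cofactor a unit, and a shift that multiplies a polynomial by a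
  unit fixes it. Distinct orbit members are thus not associated.\<close>

lemma orbit_dvd_imp_eq:
  assumes "e \<in> orbit" "e' \<in> orbit" "e dvd e'"
  shows "e = e'"
proof -
  interpret e: mpoly_irreducible m e by (rule orbit_irreducible) fact
  interpret e': mpoly_irreducible m e' by (rule orbit_irreducible) fact
  obtain c where c: "e' = e * c" using assms(3) ..
  then have unit: "c dvd 1"
    using e'.irr e.not_dvd_1 by (auto simp: irreducible_def)
  let ?k = "\<lambda>i. orbit_rep e' i - orbit_rep e i"
  have "shift_poly ?k e = shift_poly ?k (shift_poly (orbit_rep e) d)"
    using orbit_rep[OF assms(1)] by simp
  also have "\<dots> = e'"
    using orbit_rep[OF assms(2)] by (simp add: shift_poly_shift_poly)
  finally have *: "shift_poly ?k e = e'" .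
  then have "shift_poly ?k e = e"
    using shift_poly_eq_unit_mult[of ?k e c] unit c by (simp add: mult.commute)
  then show ?thesis using * by simp
qed

text \<open>After one orbit divisor \<open>e\<close> is split off, any other one is prime and not
  associated to \<open>e\<close>, so it divides the cofactor, whose degree in \<open>x_1\<close> is
  smaller.\<close>

lemma finite_orbit_divisors:
  assumes "poly_in_vars {1..m} q" "q \<noteq> 0"
  shows "finite {e \<in> orbit. e dvd q}"
  using assms
proof (induction "deg_var 1 q" arbitrary: q rule: less_induct)
  case less
  show ?case
  proof (cases "{e \<in> orbit. e dvd q} = {}")
    case False
    then obtain e where "e \<in> orbit" "e dvd q" by blast
    then obtain q' where e: "e \<in> orbit" "q = e * q'" by (auto elim: dvdE)
    interpret e: mpoly_irreducible m e by (rule orbit_irreducible) fact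
    have "q' \<noteq> 0"
      using less.prems(2) e(2) by auto
    moreover have "poly_in_vars {1..m} q'"
      using poly_in_vars_factor(2)[of "{1..m}" e q'] less.prems by (simp flip: e(2))
    ultimately have q': "q' \<noteq> 0" "poly_in_vars {1..m} q'" .
    have "deg_var 1 q' < deg_var 1 q"
      using e.deg e.e_nz q'(1) by (simp add: e(2) deg_var_mult)
    then have fin: "finite {e \<in> orbit. e dvd q'}"
      using less.hyps q' by blast
    have "{e \<in> orbit. e dvd q} \<subseteq> insert e {e \<in> orbit. e dvd q'}"
    proof
      fix e' assume "e' \<in> {e \<in> orbit. e dvd q}"
      then have e': "e' \<in> orbit" "e' dvd e * q'" by (auto simp flip: e(2))
      interpret e': mpoly_irreducible m e' by (rule orbit_irreducible) fact
      from e'.prime_dvd[OF e.vars q'(2) e'(2)] show "e' \<in> insert e {e \<in> orbit. e dvd q'}"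
      proof
        assume "e' dvd e"
        then show ?thesis using orbit_dvd_imp_eq[OF e'(1) e(1)] by simp
      next
        assume "e' dvd q'"
        then show ?thesis using e'(1) by simp
      qed
    qed
    then show ?thesis by (rule finite_subset) (simp add: fin)
  next
    case True
    then show ?thesis by (simp only: finite.emptyI)
  qed
qed

lemma finite_support:
  assumes "f \<in> ratfun m"
  shows "finite (support f)"
proof -
  obtain p q where f: "f = Fract p q" "poly_in_vars {1..m} p" "poly_in_vars {1..m} q" "q \<noteq> 0"
    using assms by (rule ratfunE)
  have "support f \<subseteq> {e \<in> orbit. e dvd q}"
    using f(2,3) mpoly_irreducible.pole_coeff_regular[OF orbit_irreducible regular_atI j]
    by (auto simp: support_def f(1))
  then show ?thesis
    using finite_orbit_divisors[OF f(3,4)] by (rule finite_subset)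
qed

text \<open>Allows traces of different functions to be compared over one common index set.\<close>

lemma orbit_trace_superset:
  assumes "finite X" "support f \<subseteq> X" "X \<subseteq> orbit"
  shows "orbit_trace f = (\<Sum>e\<in>X. shift (\<lambda>i. - orbit_rep e i) (pole_coeff m e j f))"
  unfolding orbit_trace_def using assms
  by (intro sum.mono_neutral_left) (auto simp: support_def shift_0)

lemma orbit_trace_add:
  assumes "f \<in> ratfun m" "g \<in> ratfun m"
  shows "orbit_trace (f + g) = orbit_trace f + orbit_trace g"
proof -
  define X where "X = support f \<union> support g \<union> support (f + g)"
  have X: "finite X" "X \<subseteq> orbit"
    unfolding X_def using assms by (auto simp: finite_support ratfun_add) (auto simp: support_def)
  have sub: "support f \<subseteq> X" "support g \<subseteq> X" "support (f + g) \<subseteq> X"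
    unfolding X_def by blast+
  have "pole_coeff m e j (f + g) = pole_coeff m e j f + pole_coeff m e j g" if "e \<in> X" for e
    using mpoly_irreducible.pole_coeff_add[OF orbit_irreducible assms j] that X by blast
  then show ?thesis
    by (simp add: orbit_trace_superset[OF X(1) _ X(2)] sub shift_add sum.distrib)
qed

lemma orbit_trace_0: "orbit_trace 0 = 0"
proof -
  have "support 0 = {}"
    using mpoly_irreducible.pole_coeff_regular[OF orbit_irreducible _ j]
      mpoly_irreducible.regular_0[OF orbit_irreducible]
    by (auto simp: support_def)
  then show ?thesis by (simp add: orbit_trace_def)
qed

text \<open>On the orbit the only possible pole is \<open>d\<close>. The shift on the right remains
  because the representative of \<open>d\<close> is a chosen one.\<close>

lemma orbit_trace_power:
  assumes "K a"
  shows "orbit_trace (a / pole ^ j) = shift (\<lambda>i. - orbit_rep d i) a"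
proof -
  obtain p q where a: "a = Fract p q" "poly_in_vars {1..m} p" "poly_in_vars {2..m} q" "q \<noteq> 0"
    using assms deg by (rule in_K_x1_deg_ltE)
  have "pole_coeff m e j (a / pole ^ j) = 0" if e: "e \<in> orbit" "e \<noteq> d" for e
  proof -
    interpret e: mpoly_irreducible m e by (rule orbit_irreducible) fact
    have "\<not> e dvd d ^ i" for i
      using e.prime_dvd[OF vars] orbit_dvd_imp_eq[OF e(1) d_in_orbit] e(2) e.not_dvd_1 vars
      by (induction i) (auto intro: poly_in_vars_power)
    then have "\<not> e dvd q * d ^ j"
      using e.prime_dvd[of q "d ^ j"] e.not_dvd_free[OF a(3,4)] a(3) vars
      by (auto intro: poly_in_vars_power weaken)
    then have "Fract p (q * d ^ j) \<in> regular_at m e"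
      using a vars by (auto intro!: regular_atI poly_in_vars_mult poly_in_vars_power intro: weaken)
    then show ?thesis
      using e.pole_coeff_regular j by (simp add: a(1) Fract_power)
  qed
  then have "support (a / pole ^ j) \<subseteq> {d}"
    by (auto simp: support_def)
  then have "orbit_trace (a / pole ^ j) =
      (\<Sum>e\<in>{d}. shift (\<lambda>i. - orbit_rep e i) (pole_coeff m e j (a / pole ^ j)))"
    using d_in_orbit by (intro orbit_trace_superset) auto
  then show ?thesis
    using pole_coeff_power[OF assms j] by simp
qed

lemma support_shift:
  assumes "f \<in> ratfun m" "k \<in> shift_vecs n"
  shows "support (shift k f) = shift_poly k ` support f"
proof -
  have coeff: "pole_coeff m (shift_poly k e) j (shift k f) = shift k (pole_coeff m e j f)"
    if "e \<in> orbit" for e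
    using mpoly_irreducible.pole_coeff_shift[OF orbit_irreducible assms(1) j] that by blast
  have nz: "shift k g = 0 \<longleftrightarrow> g = 0" for g :: "'a mpoly fract"
  proof
    assume "shift k g = 0"
    then have "shift (\<lambda>i. - k i) (shift k g) = 0" by (simp add: shift_0)
    then show "g = 0" by (simp add: shift_shift shift_id)
  qed (simp add: shift_0)
  show ?thesis
  proof (intro equalityI subsetI)
    fix e assume e: "e \<in> support (shift k f)"
    define e' where "e' = shift_poly (\<lambda>i. - k i) e"
    have e': "e' \<in> orbit" "e = shift_poly k e'"
      using e orbit_shift[OF _ shift_vecs_uminus[OF assms(2)]]
      by (auto simp: e'_def support_def shift_poly_uminus_cancel)
    then show "e \<in> shift_poly k ` support f"
      using e coeff[OF e'(1)] by (auto simp: support_def nz)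
  next
    fix e assume "e \<in> shift_poly k ` support f"
    then show "e \<in> support (shift k f)"
      using coeff assms(2) by (auto simp: support_def nz orbit_shift)
  qed
qed

text \<open>Reindexing the trace by \<open>e \<mapsto> shift_poly k e\<close> turns the difference
  into a finite sum of terms \<open>Delta \<rho> b\<close> with \<open>\<rho>\<close> in the
  isotropy group.\<close>

lemma orbit_trace_shift:
  assumes M: "0 \<in> M" "\<And>x y. x \<in> M \<Longrightarrow> y \<in> M \<Longrightarrow> x + y \<in> M"
    and iso: "\<And>k b. k \<in> isotropy n d \<Longrightarrow> K b \<Longrightarrow> Delta k b \<in> M"
    and f: "f \<in> ratfun m" and k: "k \<in> shift_vecs n"
  shows "orbit_trace (shift k f) - orbit_trace f \<in> M"
proof -
  have sumM: "sum g X \<in> M" if "\<And>x. x \<in> X \<Longrightarrow> g x \<in> M" for g and X :: "'a mpoly set"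
    using that by (induction X rule: infinite_finite_induct) (auto intro: M)
  let ?c = "\<lambda>e. pole_coeff m e j f" and ?r = "\<lambda>e i. - orbit_rep e i"
  have inj: "inj_on (shift_poly k) (support f)"
    by (auto simp: inj_on_def shift_poly_eq_iff)
  have "orbit_trace (shift k f) = (\<Sum>e\<in>support f. shift (?r (shift_poly k e))
      (pole_coeff m (shift_poly k e) j (shift k f)))"
    unfolding orbit_trace_def support_shift[OF f k] by (simp add: sum.reindex[OF inj])
  also have "\<dots> = (\<Sum>e\<in>support f. shift (?r (shift_poly k e)) (shift k (?c e)))"
    by (intro sum.cong refl arg_cong[of _ _ "shift _"]
        mpoly_irreducible.pole_coeff_shift[OF orbit_irreducible f j]) (simp add: support_def)
  finally have "orbit_trace (shift k f) - orbit_trace f =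
      (\<Sum>e\<in>support f. shift (?r (shift_poly k e)) (shift k (?c e)) - shift (?r e) (?c e))"
    by (simp add: orbit_trace_def sum_subtractf)
  also have "\<dots> \<in> M"
  proof (rule sumM)
    fix e assume "e \<in> support f"
    then have e: "e \<in> orbit" by (simp add: support_def)
    then have ke: "shift_poly k e \<in> orbit" by (rule orbit_shift[OF _ k])
    interpret e: mpoly_irreducible m e by (rule orbit_irreducible) fact
    \<comment> \<open>Applied to \<open>d\<close>, this moves to \<open>e\<close>, then by
      \<open>k\<close> to \<open>shift_poly k e\<close>, and then back to \<open>d\<close>.\<close>
    define \<rho> where "\<rho> = (\<lambda>i. ?r (shift_poly k e) i + (k i + orbit_rep e i))"
    define b where "b = shift (?r e) (?c e)"
    have "shift_poly \<rho> d = shift_poly (?r (shift_poly k e)) (shift_poly k (shift_poly (orbit_rep e) d))"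
      by (simp add: \<rho>_def shift_poly_shift_poly)
    also have "\<dots> = shift_poly (?r (shift_poly k e)) (shift_poly (orbit_rep (shift_poly k e)) d)"
      using orbit_rep(2)[OF e] orbit_rep(2)[OF ke] by simp
    also have "\<dots> = d"
      by (rule shift_poly_uminus_cancel)
    finally have "\<rho> \<in> isotropy n d"
      unfolding isotropy_iff \<rho>_def
      using orbit_rep(1)[OF e] orbit_rep(1)[OF ke] k
      by (intro conjI shift_vecs_add shift_vecs_uminus)
    moreover have "deg_var 1 e = deg_var 1 d"
      using orbit_rep(2)[OF e] deg_var_shift_poly by metis
    then have "K b"
      using e.pole_coeff_in_K[OF f j] deg by (simp add: b_def in_K_x1_deg_lt_shift)
    moreover have "shift (?r (shift_poly k e)) (shift k (?c e)) - shift (?r e) (?c e) = Delta \<rho> b"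
      by (simp add: Delta_def b_def \<rho>_def shift_shift)
    ultimately show "shift (?r (shift_poly k e)) (shift k (?c e)) - shift (?r e) (?c e) \<in> M"
      using iso by simp
  qed
  finally show ?thesis .
qed

lemma orbit_trace_summable:
  assumes M: "0 \<in> M" "\<And>x y. x \<in> M \<Longrightarrow> y \<in> M \<Longrightarrow> x + y \<in> M"
    and iso: "\<And>k b. k \<in> isotropy n d \<Longrightarrow> K b \<Longrightarrow> Delta k b \<in> M"
    and f: "summable m n f"
  shows "orbit_trace f \<in> M"
proof -
  obtain g where g: "\<And>i. i \<in> {1..n} \<Longrightarrow> g i \<in> ratfun m"
      "f = (\<Sum>i=1..n. shift (unitvec i) (g i) - g i)"
    using f unfolding summable_def by blast
  let ?h = "\<lambda>i. shift (unitvec i) (g i) - g i"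
  have h: "?h i \<in> ratfun m" if "i \<in> {1..n}" for i
    using g(1)[OF that] by (intro ratfun_diff ratfun_shift)
  have summand: "orbit_trace (?h i) \<in> M" if i: "i \<in> {1..n}" for i
  proof -
    \<comment> \<open>Additivity is applied to \<open>?h i + g i\<close>, which avoids a separate
      law for differences.\<close>
    have "orbit_trace (shift (unitvec i) (g i)) = orbit_trace (?h i) + orbit_trace (g i)"
      using orbit_trace_add[OF h[OF i] g(1)[OF i]] by simp
    then show ?thesis
      using orbit_trace_shift[OF M iso g(1)[OF i] unitvec_in_shift_vecs[OF i]] by simp
  qed
  have "orbit_trace (\<Sum>i\<in>I. ?h i) \<in> M" if "I \<subseteq> {1..n}" for I
    using that
  proof (induction I rule: infinite_finite_induct)
    case (insert i I)
    then have i: "i \<in> {1..n}" and "(\<Sum>i\<in>I. ?h i) \<in> ratfun m"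
      using h by (auto intro!: ratfun_sum)
    then show ?case
      using insert summand[OF i] by (simp add: orbit_trace_add[OF h[OF i]] M(2))
  qed (simp_all add: orbit_trace_0 M(1))
  then show ?thesis unfolding g(2) by blast
qed

lemma summable_imp_mem:
  assumes M: "0 \<in> M" "\<And>x y. x \<in> M \<Longrightarrow> y \<in> M \<Longrightarrow> x + y \<in> M" "\<And>x. x \<in> M \<Longrightarrow> - x \<in> M"
    and iso: "\<And>k b. k \<in> isotropy n d \<Longrightarrow> K b \<Longrightarrow> Delta k b \<in> M"
    and a: "K a" and summable: "summable m n (a / pole ^ j)"
  shows "a \<in> M"
proof -
  let ?k = "\<lambda>i. - orbit_rep d i"
  have "?k \<in> isotropy n d"
    using orbit_rep[OF d_in_orbit] shift_poly_uminus_cancel(1)[of "orbit_rep d" d]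
    by (simp add: isotropy_iff shift_vecs_uminus)
  then have "Delta ?k a \<in> M" using iso a by blast
  moreover have "shift ?k a \<in> M"
    using orbit_trace_summable[OF M(1,2) iso summable] orbit_trace_power[OF a] by simp
  \<comment> \<open>This sum equals \<open>a\<close>, which undoes the twist by the representative
    of \<open>d\<close>.\<close>
  ultimately have "shift ?k a + - Delta ?k a \<in> M"
    by (intro M)
  then show ?thesis by (simp add: Delta_def)
qed

end

section \<open>The summability criterion for a single pole\<close>

theorem theorem1p3:
  fixes m n j :: nat
    and a :: "'a::field_char_0 mpoly fract"
    and d :: "'a mpoly"
    and ts :: "(nat \<Rightarrow> int) list"
  assumes "1 \<le> n" "n \<le> m" "1 \<le> j"
    and "irreducible_in m d" "deg_var 1 d > 0"
    and "in_K_x1_deg_lt m (deg_var 1 d) a"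
    and "group_basis (isotropy n d) ts"
  shows "summable m n (a / (Fract d 1) ^ j) \<longleftrightarrow>
    (\<exists>b. (\<forall>i<length ts. in_K_x1_deg_lt m (deg_var 1 d) (b i)) \<and>
         a = (\<Sum>i<length ts. Delta (ts ! i) (b i)))"
proof -
  interpret shift_orbit m d n j
    using assms by unfold_locales (auto simp: irreducible_in_iff)
  \<comment> \<open>An additive group; both directions are stated as membership in it.\<close>
  define M :: "'a mpoly fract set" where "M = {\<Sum>i<length ts. Delta (ts ! i) (b i) | b. \<forall>i<length ts. K (b i)}"
  have M0: "0 \<in> M"
    unfolding M_def by (intro CollectI exI[of _ "\<lambda>_. 0"]) (simp add: Delta_0 in_K_x1_deg_lt_0)
  have Madd: "x + y \<in> M" if xy: "x \<in> M" "y \<in> M" for x y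
  proof -
    obtain b b' where "\<forall>i<length ts. K (b i)" "x = (\<Sum>i<length ts. Delta (ts ! i) (b i))"
      "\<forall>i<length ts. K (b' i)" "y = (\<Sum>i<length ts. Delta (ts ! i) (b' i))"
      using xy unfolding M_def by blast
    then show ?thesis
      unfolding M_def by (intro CollectI exI[of _ "\<lambda>i. b i + b' i"])
        (simp add: Delta_add sum.distrib in_K_x1_deg_lt_add deg)
  qed
  have Mneg: "- x \<in> M" if x: "x \<in> M" for x
  proof -
    obtain b where "\<forall>i<length ts. K (b i)" "x = (\<Sum>i<length ts. Delta (ts ! i) (b i))"
      using x unfolding M_def by blast
    then show ?thesis
      unfolding M_def by (intro CollectI exI[of _ "\<lambda>i. - b i"])
        (simp add: Delta_uminus sum_negf in_K_x1_deg_lt_uminus deg)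
  qed
  have gen: "Delta (ts ! i) b \<in> M" if "i \<in> {..<length ts}" "b \<in> Collect K" for i b
  proof -
    have "(\<Sum>l<length ts. Delta (ts ! l) (if l = i then b else 0)) =
        (\<Sum>l<length ts. if l = i then Delta (ts ! l) b else 0)"
      by (intro sum.cong) (auto simp: Delta_0)
    then show ?thesis
      using that unfolding M_def by (intro CollectI exI[of _ "\<lambda>l. if l = i then b else 0"])
        (simp add: sum.delta in_K_x1_deg_lt_0)
  qed
  \<comment> \<open>A nontrivial isotropy group consists of integer combinations of
    \<open>ts\<close>; for a trivial one, \<open>Delta\<close> of the zero vector vanishes.\<close>
  have iso: "Delta k b \<in> M" if k: "k \<in> isotropy n d" and b: "K b" for k b
  proof (cases "isotropy n d = {\<lambda>_. 0}")
    case True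
    then show ?thesis using k M0 by (simp add: Delta_def shift_id)
  next
    case False
    then have "\<forall>k\<in>isotropy n d. \<exists>c. k = (\<lambda>l. \<Sum>i<length ts. c i * (ts ! i) l)"
      using assms(7) by (simp only: group_basis_def if_False) blast
    then obtain c where "k = (\<lambda>l. \<Sum>i<length ts. c i * (ts ! i) l)"
      using k by blast
    moreover have "Delta (\<lambda>l. \<Sum>i\<in>{..<length ts}. c i * (ts ! i) l) b \<in> M"
      by (rule Delta_int_combination[where A = "Collect K"])
        (use b M0 Madd Mneg gen in \<open>auto intro: in_K_x1_deg_lt_shift deg\<close>)
    ultimately show ?thesis by simp
  qed
  have "set ts \<subseteq> isotropy n d"
  proof (cases "isotropy n d = {\<lambda>_. 0}")
    case True
    then show ?thesis using assms(7) by (simp add: group_basis_def)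
  next
    case False
    then show ?thesis using assms(7) by (simp only: group_basis_def if_False)
  qed
  then have ts: "ts ! i \<in> isotropy n d" if "i < length ts" for i
    using nth_mem[OF that] by blast
  have "summable m n (a / pole ^ j) \<longleftrightarrow> a \<in> M"
  proof
    assume "summable m n (a / pole ^ j)"
    then show "a \<in> M"
      using summable_imp_mem[OF M0 Madd Mneg iso assms(6)] by blast
  next
    assume "a \<in> M"
    then obtain b where b: "\<And>i. i < length ts \<Longrightarrow> K (b i)"
      "a = (\<Sum>i<length ts. Delta (ts ! i) (b i))"
      unfolding M_def by blast
    \<comment> \<open>The shift fixes \<open>d\<close>, so division by its power commutes with
      \<open>Delta\<close>.\<close>
    have "Delta (ts ! i) (b i) / pole ^ j = Delta (ts ! i) (b i / pole ^ j)" if "i < length ts" for i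
      using ts[OF that]
      by (simp add: isotropy_iff Delta_def shift_divide shift_power shift_Fract_1 diff_divide_distrib)
    then have "a / pole ^ j = (\<Sum>i<length ts. Delta (ts ! i) (b i / pole ^ j))"
      by (simp add: b(2) sum_divide_distrib)
    moreover have "b i / pole ^ j \<in> ratfun m" if i: "i < length ts" for i
    proof -
      obtain p q where "b i = Fract p q" "poly_in_vars {1..m} p" "poly_in_vars {1..m} q" "q \<noteq> 0"
        using in_K_x1_deg_lt_ratfun[OF b(1)[OF i]] by (rule ratfunE)
      then show ?thesis
        using vars e_nz
        by (auto simp: Fract_power intro!: ratfunI poly_in_vars_mult poly_in_vars_power)
    qed
    ultimately show "summable m n (a / pole ^ j)"
      using ts by (auto simp: isotropy_iff intro!: summable_sum summable_Delta)
  qed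
  then show ?thesis
    unfolding M_def by blast
qed

end
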